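(* Let $\ell\ge 1$ be an integer. The derivations $\theta_E,\varphi_1^C,\dots,\varphi_\ell^C$ form a basis of the $S$-module $D(\mathcal{S}(C_\ell))$; that is, they belong to $D(\mathcal{S}(C_\ell))$ and $D(\mathcal{S}(C_\ell))$ is a free $S$-module with basis $\theta_E,\varphi_1^C,\dots,\varphi_\ell^C$.
   Context: Let $S=\mathbb{R}[x_1,\dots,x_\ell,z]$ be the polynomial ring, with $x_1,\dots,x_\ell$ an orthonormal basis of the dual $E^*$ of an $\ell$-dimensional real Euclidean space $E$ and $z$ an additional coordinate. $\mathrm{Der}(S)$ is the $S$-module of $\mathbb{R}$-linear derivations $S\to S$; $\partial_i=\partial/\partial x_i$, $\partial_z=\partial/\partial z$. Positive roots of type $C_\ell$: $\Phi_+^C=\{2x_i,\ x_p\pm x_q \mid 1\le i\le\ell,\ 1\le p<q\le\ell\}$. $\mathcal{S}(C_\ell)$ denotes the cone over the Shi arrangement of type $C_\ell$, i.e. the central arrangement in $\mathbb{R}^{\ell+1}$ defined by $z\prod_{\alpha\in\Phi_+^C}\alpha(\alpha-z)=0$. Its derivation module $D(\mathcal{S}(C_\ell))$ is the $S$-submodule of all $\theta\in\mathrm{Der}(S)$ such that $\theta(z)$ is divisible by $z$, and for every $\alpha\in\Phi_+^C$, $\theta(\alpha)$ is divisible by $\alpha$ and $\theta(\alpha-z)$ is divisible by $\alpha-z$. For integers $r\ge1$, $s\ge0$, $B_{r,s}^C(x)\in\mathbb{R}[x]$ is the unique polynomial with $B_{r,s}^C(0)=0$ and $$B_{r,s}^C(x+1)-B_{r,s}^C(x)=\{(x+1)^{r-1}+(-x)^{r-1}\}(x+1)^s(-x)^s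 .$$ It has degree $\le r+2s$; its homogenization is the polynomial $\overline{B}_{r,s}^C(x,z):=z^{r+2s}B_{r,s}^C(x/z)$. For $1\le j\le\ell$ put $I_1^{(j)}=\{x_1,\dots,x_{j-1}\}$. Let $\sigma_k$ denote the elementary symmetric polynomial of degree $k$ ($\sigma_0=1$), and set $\sigma_k^{(2,j)}:=\sigma_k(x_j)$ (so $\sigma_0^{(2,j)}=1$, $\sigma_1^{(2,j)}=x_j$) and $\tau_k^{(3,j)}:=\sigma_k(x_{j+1}^2,\dots,x_\ell^2)$. The Euler derivation is $\theta_E:=z\partial_z+\sum_{i=1}^\ell x_i\partial_i$. For $1\le j\le\ell$ define $$\varphi_j^C:=(-1)^j\sum_{i=1}^\ell\Bigl\{\sum_{\substack{N_1,N_2\subset I_1^{(j)}\\N_1\cap N_2=\emptyset}}\Bigl(\prod_{x_t\in N_1}x_t^2\Bigr)\Bigl(\prod_{x_t\in N_2}(-x_tz)\Bigr)\sum_{\substack{0\le k_2\le1\\0\le k_3\le\ell-j}}(-1)^{k_2+k_3}\sigma_{k_2}^{(2,j)}\tau_{k_3}^{(3,j)}\,\overline{B}_{r,s}^C(x_i,z)\Bigr\}\partial_i,$$ where in each term $r:=2\ell-2j-k_2-2k_3+2\ge1$ and $s:=(j-1)-|N_1|-|N_2|\ge0$. *)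

theory Defs
  imports
    Complex_Main
    "HOL-Library.FuncSet"
    "HOL-Library.Poly_Mapping"
    "HOL-Computational_Algebra.Polynomial"
begin

section \<open>The polynomial ring\<close>

text \<open>Polynomials are finitely supported families of coefficients indexed by monomials
  \<open>nat \<Rightarrow>\<^sub>0 nat\<close>. The indeterminate of index \<open>0\<close> is \<open>z\<close>, written \<open>Z\<close>; the one of
  index \<open>i \<ge> 1\<close> is \<open>x\<^sub>i\<close>, written \<open>X i\<close>.
  The type has infinitely many indeterminates; \<open>S l\<close> is the subring
  \<open>\<real>[x\<^sub>1, \<dots>, x\<^sub>l, z]\<close>, and all notions below are relative to it.\<close>

type_synonym mpoly = "(nat \<Rightarrow>\<^sub>0 nat) \<Rightarrow>\<^sub>0 real"

definition cst :: "real \<Rightarrow> mpoly" where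
  "cst c = Poly_Mapping.single 0 c"

definition indet :: "nat \<Rightarrow> mpoly" where
  "indet i = Poly_Mapping.single (Poly_Mapping.single i 1) 1"

abbreviation X :: "nat \<Rightarrow> mpoly" where
  "X i \<equiv> indet i"

abbreviation Z :: mpoly where
  "Z \<equiv> indet 0"

definition S :: "nat \<Rightarrow> mpoly set" where
  "S l = {f. \<forall>m \<in> Poly_Mapping.keys f. Poly_Mapping.keys m \<subseteq> {0..l}}"

definition dvd_in :: "mpoly set \<Rightarrow> mpoly \<Rightarrow> mpoly \<Rightarrow> bool" where
  "dvd_in R a b \<longleftrightarrow> (\<exists>q \<in> R. b = a * q)"

text \<open>In the formal partial derivative, the subtraction of monomials is truncated, but the
  coefficient vanishes whenever the truncation has an effect.\<close>

definition partial :: "nat \<Rightarrow> mpoly \<Rightarrow> mpoly" where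
  "partial i f = (\<Sum>m \<in> Poly_Mapping.keys f.
     Poly_Mapping.single (m - Poly_Mapping.single i 1)
       (of_nat (Poly_Mapping.lookup m i) * Poly_Mapping.lookup f m))"


section \<open>Derivations and bases\<close>

text \<open>Maps \<open>S l \<rightarrow> S l\<close> are taken extensional (\<open>undefined\<close> outside \<open>S l\<close>), so that
  equality of derivations is equality of functions.\<close>

definition Der :: "nat \<Rightarrow> (mpoly \<Rightarrow> mpoly) set" where
  "Der l = {\<theta> \<in> S l \<rightarrow>\<^sub>E S l.
     (\<forall>f \<in> S l. \<forall>g \<in> S l. \<theta> (f + g) = \<theta> f + \<theta> g) \<and>
     (\<forall>c. \<forall>f \<in> S l. \<theta> (cst c * f) = cst c * \<theta> f) \<and>
     (\<forall>f \<in> S l. \<forall>g \<in> S l. \<theta> (f * g) = \<theta> f * g + f * \<theta> g)}"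

definition lin_comb ::
    "nat \<Rightarrow> 'k set \<Rightarrow> ('k \<Rightarrow> mpoly) \<Rightarrow> ('k \<Rightarrow> mpoly \<Rightarrow> mpoly) \<Rightarrow> mpoly \<Rightarrow> mpoly" where
  "lin_comb l K c b = (\<lambda>f \<in> S l. \<Sum>k \<in> K. c k * b k f)"

text \<open>The finite family \<open>(b k)\<^sub>k\<^sub>\<in>\<^sub>K\<close> is a basis of the \<open>S l\<close>-module \<open>M\<close>: the module of all linear
  combinations is exactly \<open>M\<close>, and the family is linearly independent.\<close>

definition is_basis :: "nat \<Rightarrow> 'k set \<Rightarrow> ('k \<Rightarrow> mpoly \<Rightarrow> mpoly) \<Rightarrow> (mpoly \<Rightarrow> mpoly) set \<Rightarrow> bool" where
  "is_basis l K b M \<longleftrightarrow>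
     finite K \<and>
     {lin_comb l K c b | c. c \<in> K \<rightarrow> S l} = M \<and>
     (\<forall>c \<in> K \<rightarrow> S l. lin_comb l K c b = (\<lambda>f \<in> S l. 0) \<longrightarrow> (\<forall>k \<in> K. c k = 0))"


section \<open>The cone over the Shi arrangement of type C\<close>

definition pos_roots_C :: "nat \<Rightarrow> mpoly set" where
  "pos_roots_C l =
     {2 * X i | i. 1 \<le> i \<and> i \<le> l} \<union>
     {X p + X q | p q. 1 \<le> p \<and> p < q \<and> q \<le> l} \<union>
     {X p - X q | p q. 1 \<le> p \<and> p < q \<and> q \<le> l}"

definition D_Shi_C :: "nat \<Rightarrow> (mpoly \<Rightarrow> mpoly) set" where
  "D_Shi_C l = {\<theta> \<in> Der l. dvd_in (S l) Z (\<theta> Z) \<and>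
     (\<forall>\<alpha> \<in> pos_roots_C l. dvd_in (S l) \<alpha> (\<theta> \<alpha>) \<and> dvd_in (S l) (\<alpha> - Z) (\<theta> (\<alpha> - Z)))}"


section \<open>The Bernoulli-type polynomials\<close>

definition B_spec :: "nat \<Rightarrow> nat \<Rightarrow> real poly \<Rightarrow> bool" where
  "B_spec r s p \<longleftrightarrow> poly p 0 = 0 \<and>
     (\<forall>t. poly p (t + 1) - poly p t
        = ((t + 1) ^ (r - 1) + (- t) ^ (r - 1)) * (t + 1) ^ s * (- t) ^ s)"

definition B_C :: "nat \<Rightarrow> nat \<Rightarrow> real poly" where
  "B_C r s = (THE p. B_spec r s p)"

text \<open>Existence, uniqueness and the degree bound, for \<open>r \<ge> 1\<close>.\<close>

lemma difference_equation:
  fixes q :: "real poly"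
  assumes "\<And>k. k \<ge> n \<Longrightarrow> coeff q k = 0"
  shows "\<exists>p. poly p 0 = 0 \<and> (\<forall>t. poly p (t + 1) - poly p t = poly q t) \<and> degree p \<le> n"
  using assms
proof (induction n arbitrary: q)
  case 0
  then have "q = 0" by (simp add: poly_eq_iff)
  then show ?case by (intro exI[of _ 0]) simp
next
  case (Suc n)
  define F :: "nat \<Rightarrow> real poly" where "F = (\<lambda>k. \<Prod>i<k. [:- real i, 1:])"
  have F_degree: "degree (F k) = k" for k
    unfolding F_def by (subst degree_prod_eq_sum_degree) auto
  have F_lead: "coeff (F k) k = 1" for k
    using lead_coeff_prod[of "\<lambda>i. [:- real i, 1:]" "{..<k}"] F_degree[of k]
    by (simp add: F_def)
  have F_shift: "poly (F (Suc n)) (t + 1) - poly (F (Suc n)) t = real (Suc n) * poly (F n) t" for t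
  proof -
    have "poly (F (Suc n)) (t + 1) = (t + 1) * (\<Prod>i<n. t - real i)"
      unfolding F_def by (subst prod.lessThan_Suc_shift) (simp add: poly_prod)
    moreover have "poly (F (Suc n)) t = (t - real n) * (\<Prod>i<n. t - real i)"
      unfolding F_def by (simp add: poly_prod algebra_simps)
    moreover have "poly (F n) t = (\<Prod>i<n. t - real i)"
      by (simp add: F_def poly_prod)
    ultimately show ?thesis by (simp add: algebra_simps)
  qed
  define a where "a = coeff q n"
  have "coeff (q - smult a (F n)) k = 0" if "k \<ge> n" for k
    using that Suc.prems[of k] F_lead[of n] F_degree[of n]
    by (cases "k = n") (auto simp: a_def coeff_eq_0)
  from Suc.IH[OF this] obtain p where p: "poly p 0 = 0" "degree p \<le> n"
    "\<And>t. poly p (t + 1) - poly p t = poly (q - smult a (F n)) t" by blast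
  define p' where "p' = p + smult (a / real (Suc n)) (F (Suc n))"
  have "poly (F (Suc n)) 0 = 0"
    by (simp add: F_def poly_prod del: prod.lessThan_Suc)
  then have "poly p' 0 = 0" using p(1) by (simp add: p'_def)
  moreover have "poly p' (t + 1) - poly p' t = poly q t" for t
  proof -
    have "poly p' (t + 1) - poly p' t = (poly p (t + 1) - poly p t)
        + a / real (Suc n) * (poly (F (Suc n)) (t + 1) - poly (F (Suc n)) t)"
      by (simp add: p'_def right_diff_distrib)
    also have "\<dots> = poly q t" by (simp only: p(3) F_shift) simp
    finally show ?thesis .
  qed
  moreover have "degree p' \<le> Suc n"
    unfolding p'_def using p(2) F_degree[of "Suc n"]
    by (intro degree_add_le) (auto intro: order_trans[OF degree_smult_le])
  ultimately show ?case by blast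
qed

lemma B_spec_exists:
  assumes "r \<ge> 1"
  shows "\<exists>p. B_spec r s p \<and> degree p \<le> r + 2 * s"
proof -
  define q :: "real poly" where
    "q = ([:1, 1:] ^ (r - 1) + [:0, -1:] ^ (r - 1)) * [:1, 1:] ^ s * [:0, -1:] ^ s"
  have "degree ([:1, 1:] ^ k :: real poly) \<le> k" "degree ([:0, -1:] ^ k :: real poly) \<le> k" for k
    by (rule order_trans[OF degree_power_le]; simp)+
  then have "degree q \<le> (r - 1) + s + s"
    unfolding q_def
    by (intro order_trans[OF degree_mult_le] add_mono degree_add_le) auto
  then have "coeff q k = 0" if "k \<ge> r + 2 * s" for k
    using that assms by (intro coeff_eq_0) simp
  from difference_equation[OF this] show ?thesis
    by (auto simp: B_spec_def q_def poly_power add.commute)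
qed

lemma B_spec_unique:
  assumes "B_spec r s p" "B_spec r s p'"
  shows "p = p'"
proof -
  have "poly (p - p') (real n) = 0" for n
  proof (induction n)
    case 0
    then show ?case using assms by (simp add: B_spec_def)
  next
    case (Suc n)
    have "poly p (real n + 1) - poly p (real n) = poly p' (real n + 1) - poly p' (real n)"
      using assms by (simp add: B_spec_def)
    with Suc show ?case by (simp add: add.commute)
  qed
  then have "range real \<subseteq> {t. poly (p - p') t = 0}" by auto
  moreover have "infinite (range real)"
    by (rule range_inj_infinite) (simp add: inj_on_def)
  ultimately have "infinite {t. poly (p - p') t = 0}" using finite_subset by blast
  then show ?thesis using poly_roots_finite[of "p - p'"] by auto
qed

lemma B_C_spec:
  assumes "r \<ge> 1"
  shows "B_spec r s (B_C r s)" and "degree (B_C r s) \<le> r + 2 * s"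
proof -
  obtain p where p: "B_spec r s p" "degree p \<le> r + 2 * s" using B_spec_exists[OF assms] by blast
  then have "B_C r s = p"
    unfolding B_C_def by (intro the_equality) (auto intro: B_spec_unique)
  with p show "B_spec r s (B_C r s)" "degree (B_C r s) \<le> r + 2 * s" by auto
qed

text \<open>The homogenization \<open>z\<^bsup>r+2s\<^esup> B(u/z)\<close>, evaluated at \<open>u\<close>. By the degree bound, no
  coefficient is dropped.\<close>

definition B_bar :: "nat \<Rightarrow> nat \<Rightarrow> mpoly \<Rightarrow> mpoly" where
  "B_bar r s u = (\<Sum>k\<le>r + 2 * s. cst (coeff (B_C r s) k) * u ^ k * Z ^ (r + 2 * s - k))"


section \<open>The basis derivations\<close>

definition esym :: "nat \<Rightarrow> nat set \<Rightarrow> (nat \<Rightarrow> mpoly) \<Rightarrow> mpoly" where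
  "esym k A f = (\<Sum>T | T \<subseteq> A \<and> card T = k. \<Prod>i\<in>T. f i)"

definition euler :: "nat \<Rightarrow> mpoly \<Rightarrow> mpoly" where
  "euler l = (\<lambda>f \<in> S l. Z * partial 0 f + (\<Sum>i=1..l. X i * partial i f))"

text \<open>The subsets \<open>N\<^sub>1, N\<^sub>2\<close> of \<open>{x\<^sub>1, \<dots>, x\<^sub>j\<^sub>-\<^sub>1}\<close> are represented by their sets of indices. No
  subtraction of natural numbers in the subscripts of \<open>B_bar\<close> is truncated, and the first
  subscript is at least \<open>1\<close>.\<close>

definition phi_coeff :: "nat \<Rightarrow> nat \<Rightarrow> nat \<Rightarrow> mpoly" where
  "phi_coeff l j i =
     (\<Sum>(N1, N2) \<in> {(N1, N2). N1 \<subseteq> {1..<j} \<and> N2 \<subseteq> {1..<j} \<and> N1 \<inter> N2 = {}}.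
        (\<Prod>t\<in>N1. (X t)\<^sup>2) * (\<Prod>t\<in>N2. - (X t * Z)) *
        (\<Sum>k2=0..1. \<Sum>k3=0..l - j.
           (- 1) ^ (k2 + k3) * esym k2 {j} X * esym k3 {j+1..l} (\<lambda>t. (X t)\<^sup>2) *
           B_bar (2 * l + 2 - 2 * j - k2 - 2 * k3) ((j - 1) - card N1 - card N2) (X i)))"

definition phi_C :: "nat \<Rightarrow> nat \<Rightarrow> mpoly \<Rightarrow> mpoly" where
  "phi_C l j = (\<lambda>f \<in> S l. (- 1) ^ j * (\<Sum>i=1..l. phi_coeff l j i * partial i f))"

end

theory Submission
  imports Defs "Jordan_Normal_Form.Determinant"
begin

text \<open>The \<open>i\<close>-th coefficient of \<open>\<phi>\<^sub>j\<close> is, up to the sign \<open>(-1)\<^sup>j\<close>, the value \<open>P\<^sub>j(x\<^sub>i)\<close> of a polynomial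
  \<open>P\<^sub>j(u)\<close> that does not depend on \<open>i\<close> (\<open>phi_poly\<close>). Everything follows from two properties of
  \<open>P\<^sub>j\<close>. It is odd (\<open>phi_poly_minus\<close>), since the right-hand side of the difference equation for the
  Bernoulli-type polynomials is invariant under \<open>t \<mapsto> -1 - t\<close>. And its difference factors
  (\<open>phi_poly_difference\<close>): the sums over \<open>N\<^sub>1, N\<^sub>2\<close> and over \<open>k\<^sub>2, k\<^sub>3\<close> are expanded products, so that
  \<open>P\<^sub>j(u + z) - P\<^sub>j(u)\<close> equals \<open>z (\<Prod>\<^sub>t\<^sub><\<^sub>j (x\<^sub>t + u)(x\<^sub>t - u - z)) (E\<^sub>j(u + z) + E\<^sub>j(-u))\<close> with
  \<open>E\<^sub>j(y) = (y - x\<^sub>j) \<Prod>\<^sub>t\<^sub>>\<^sub>j (y\<^sup>2 - x\<^sub>t\<^sup>2)\<close>.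

  Membership of \<open>\<phi>\<^sub>j\<close> in the derivation module: on a hyperplane \<open>x\<^sub>p = u + \<delta>z\<close> with \<open>u = \<plusminus> x\<^sub>q\<close>,
  \<open>p \<le> q\<close> and \<open>\<delta> \<in> {0, 1}\<close>, the difference \<open>P\<^sub>j(x\<^sub>p) - P\<^sub>j(u)\<close> is zero for \<open>\<delta> = 0\<close> and for \<open>\<delta> = 1\<close>
  contains a vanishing factor (\<open>phi_poly_hyperplane\<close>).

  Basis: the argument is that of Saito's criterion. After subtraction of a multiple of the Euler
  derivation, only the \<open>l \<times> l\<close> matrix with entries \<open>\<plusminus> P\<^sub>j(x\<^sub>i)\<close> matters. Any matrix whose columns
  satisfy the divisibility conditions has a determinant divisible by each of the \<open>2l\<^sup>2\<close> linear forms
  (\<open>form_dvd_det\<close>), hence by their product, as they are pairwise non-associate primes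
  (\<open>forms_prod_dvd\<close>). The determinant of the matrix itself is homogeneous of degree \<open>2l\<^sup>2\<close> and
  therefore a constant multiple of that product (\<open>det_phi_mat\<close>). The constant is nonzero because the
  columns are independent (\<open>phi_independent\<close>): a relation \<open>\<Sum>\<^sub>j h\<^sub>j P\<^sub>j(x\<^sub>i) = 0\<close> for all \<open>i\<close> gives an odd
  polynomial \<open>\<Sum>\<^sub>j h\<^sub>j P\<^sub>j(u)\<close> of degree at most \<open>2l\<close> with the \<open>2l + 1\<close> roots \<open>0, \<plusminus> x\<^sub>i\<close>, so it is zero, and
  evaluating its difference at \<open>u = - x\<^sub>1, - x\<^sub>2, \<dots>\<close> eliminates the \<open>h\<^sub>j\<close> one after the other. Cramer's
  rule then expresses every element of the module by the basis (\<open>admissible_spanned\<close>).\<close>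

section \<open>Substitution homomorphisms and the subring of polynomials\<close>

lemma cst_0 [simp]: "cst 0 = 0" and cst_1 [simp]: "cst 1 = 1"
  by (simp_all add: cst_def)

lemma cst_add: "cst (a + b) = cst a + cst b"
  by (simp add: cst_def single_add)

lemma cst_mult: "cst (a * b) = cst a * cst b"
  by (simp add: cst_def mult_single)

lemma cst_uminus: "cst (- a) = - cst a"
  by (simp add: cst_def single_uminus)

lemma cst_numeral [simp]: "cst (numeral n) = numeral n"
proof -
  have "cst (of_nat n) = of_nat n" for n
    by (induction n) (simp_all add: cst_add)
  from this[of "numeral n"] show ?thesis by simp
qed

lemma poly_mapping_eq_sum_single:
  "f = (\<Sum>m\<in>Poly_Mapping.keys f. Poly_Mapping.single m (Poly_Mapping.lookup f m))"
  by (rule poly_mapping_eqI)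
     (simp add: lookup_sum lookup_single when_def in_keys_iff)

lemma single_add_induct [case_names single add]:
  fixes P :: "mpoly \<Rightarrow> bool"
  assumes single: "\<And>m c. P (Poly_Mapping.single m c)"
    and add: "\<And>f g. P f \<Longrightarrow> P g \<Longrightarrow> P (f + g)"
  shows "P f"
proof -
  have "P (\<Sum>m\<in>A. Poly_Mapping.single m (c m))" for A c
    by (induction A rule: infinite_finite_induct)
       (use single[of _ 0] in \<open>auto intro: single add\<close>)
  then show ?thesis by (subst poly_mapping_eq_sum_single)
qed

lemma single_eq_cst_mult: "Poly_Mapping.single m c = cst c * Poly_Mapping.single m 1"
  by (simp add: cst_def mult_single)

lemma S_0: "0 \<in> S l" and S_cst: "cst c \<in> S l" and S_indet: "i \<le> l \<Longrightarrow> indet i \<in> S l"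
  by (auto simp: S_def cst_def indet_def)

lemma S_add: "f \<in> S l \<Longrightarrow> g \<in> S l \<Longrightarrow> f + g \<in> S l"
  using keys_add[of f g] by (auto simp: S_def subset_iff)

lemma S_sum: "(\<And>i. i \<in> A \<Longrightarrow> f i \<in> S l) \<Longrightarrow> (\<Sum>i\<in>A. f i) \<in> S l"
  by (induction A rule: infinite_finite_induct) (simp_all add: S_0 S_add)

lemma S_mult:
  assumes "f \<in> S l" "g \<in> S l"
  shows "f * g \<in> S l"
  unfolding S_def
proof safe
  fix m i assume m: "m \<in> Poly_Mapping.keys (f * g)" and i: "i \<in> Poly_Mapping.keys m"
  from m keys_mult[of f g] obtain a b
    where "a \<in> Poly_Mapping.keys f" "b \<in> Poly_Mapping.keys g" "m = a + b" by blast
  with i assms keys_add[of a b] show "i \<in> {0..l}" unfolding S_def by blast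
qed

lemma S_1: "1 \<in> S l"
  using S_cst[of 1 l] by simp

lemma S_uminus: "f \<in> S l \<Longrightarrow> - f \<in> S l"
  using S_mult[OF S_cst[of "-1" l], of f] by (simp add: cst_uminus)

lemma S_diff: "f \<in> S l \<Longrightarrow> g \<in> S l \<Longrightarrow> f - g \<in> S l"
  using S_add[of f l "- g"] S_uminus[of g l] by simp

lemma S_prod: "(\<And>i. i \<in> A \<Longrightarrow> f i \<in> S l) \<Longrightarrow> (\<Prod>i\<in>A. f i) \<in> S l"
  by (induction A rule: infinite_finite_induct) (simp_all add: S_1 S_mult)

lemma S_power: "f \<in> S l \<Longrightarrow> f ^ n \<in> S l"
  by (induction n) (simp_all add: S_1 S_mult)

lemmas S_closed = S_0 S_1 S_cst S_indet S_add S_diff S_uminus S_mult S_sum S_prod S_power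

lemma monomial_induct [case_names one indet mult]:
  fixes P :: "mpoly \<Rightarrow> bool"
  assumes "P 1" and indet: "\<And>i. i \<in> A \<Longrightarrow> P (indet i)"
    and mult: "\<And>f g. P f \<Longrightarrow> P g \<Longrightarrow> P (f * g)"
    and "Poly_Mapping.keys m \<subseteq> A"
  shows "P (Poly_Mapping.single m 1)"
  using assms(4)
proof (induction m rule: update_induct)
  case const
  then show ?case using \<open>P 1\<close> by simp
next
  case (update m i n)
  have power: "P (Poly_Mapping.single (Poly_Mapping.single i k) 1)" if "i \<in> A" for k
  proof (induction k)
    case (Suc k)
    have "Poly_Mapping.single (Poly_Mapping.single i (Suc k)) 1
        = indet i * (Poly_Mapping.single (Poly_Mapping.single i k) 1 :: mpoly)"
      by (simp add: indet_def mult_single flip: single_add)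
    then show ?case using mult[OF indet[OF that] Suc] by simp
  qed (use \<open>P 1\<close> in simp)
  have eq: "Poly_Mapping.update i n m = m + Poly_Mapping.single i n"
    using update(1) by (intro poly_mapping_eqI) (auto simp: lookup_update lookup_add lookup_single in_keys_iff when_def)
  have "insert i (Poly_Mapping.keys m) \<subseteq> A"
    using update by (simp add: keys_update)
  then have "P (Poly_Mapping.single m 1 * Poly_Mapping.single (Poly_Mapping.single i n) 1)"
    by (intro mult power update.IH) auto
  then show ?case by (simp add: eq mult_single)
qed

text \<open>Every polynomial of \<open>S l\<close> is built from constants and indeterminates by addition and
  multiplication, without leaving \<open>S l\<close>.\<close>

lemma S_induct [consumes 1, case_names cst indet add mult]:
  assumes "f \<in> S l" and cst: "\<And>c. P (cst c)" and indet: "\<And>i. i \<le> l \<Longrightarrow> P (indet i)"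
    and add: "\<And>f g. f \<in> S l \<Longrightarrow> g \<in> S l \<Longrightarrow> P f \<Longrightarrow> P g \<Longrightarrow> P (f + g)"
    and mult: "\<And>f g. f \<in> S l \<Longrightarrow> g \<in> S l \<Longrightarrow> P f \<Longrightarrow> P g \<Longrightarrow> P (f * g)"
  shows "P f"
proof -
  let ?Q = "\<lambda>f. f \<in> S l \<and> P f"
  have mon: "?Q (Poly_Mapping.single m 1)" if "m \<in> Poly_Mapping.keys f" for m
  proof (rule monomial_induct[where A = "{0..l}"])
    show "?Q 1" using cst[of 1] by (simp add: S_1)
    show "?Q (g * h)" if "?Q g" "?Q h" for g h
      using that by (simp add: S_mult mult)
    show "Poly_Mapping.keys m \<subseteq> {0..l}" using that \<open>f \<in> S l\<close> by (simp add: S_def)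
  qed (simp add: S_indet indet)
  have "?Q (\<Sum>m\<in>B. Poly_Mapping.single m (Poly_Mapping.lookup f m))"
    if "B \<subseteq> Poly_Mapping.keys f" for B
    using finite_subset[OF that finite_keys] that
  proof (induction B rule: finite_induct)
    case empty
    then show ?case using cst[of 0] by (simp add: S_0)
  next
    case (insert m B)
    then have "?Q (Poly_Mapping.single m (Poly_Mapping.lookup f m))"
      using mon[of m] by (subst single_eq_cst_mult, subst (2) single_eq_cst_mult)
        (auto intro: S_mult S_cst mult cst)
    with insert show ?case by (auto intro: add S_add)
  qed
  from this[of "Poly_Mapping.keys f"] show ?thesis
    using poly_mapping_eq_sum_single[of f] by simp
qed

lemma in_S_exists: "\<exists>l. f \<in> S l"
proof -
  let ?K = "\<Union>m\<in>Poly_Mapping.keys f. Poly_Mapping.keys m"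
  have "finite ?K" by simp
  then obtain l where "?K \<subseteq> {..l}" using finite_nat_iff_bounded_le by blast
  then have "f \<in> S l" by (force simp: S_def)
  then show ?thesis ..
qed

lemma mpoly_induct [case_names cst indet add mult]:
  assumes "\<And>c. P (cst c)" and "\<And>i. P (indet i)"
    and "\<And>f g. P f \<Longrightarrow> P g \<Longrightarrow> P (f + g)" and "\<And>f g. P f \<Longrightarrow> P g \<Longrightarrow> P (f * g)"
  shows "P f"
proof -
  obtain l where "f \<in> S l" using in_S_exists by blast
  then show ?thesis by (induction rule: S_induct) (auto intro: assms)
qed

text \<open>The \<open>\<real>\<close>-algebra endomorphism that sends each indeterminate of index \<open>i\<close> to \<open>g i\<close>.\<close>

definition subst :: "(nat \<Rightarrow> mpoly) \<Rightarrow> mpoly \<Rightarrow> mpoly" where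
  "subst g f = (\<Sum>m\<in>Poly_Mapping.keys f.
     cst (Poly_Mapping.lookup f m) * (\<Prod>i\<in>Poly_Mapping.keys m. g i ^ Poly_Mapping.lookup m i))"

lemma subst_superset:
  assumes "finite A" "Poly_Mapping.keys f \<subseteq> A"
  shows "subst g f = (\<Sum>m\<in>A.
     cst (Poly_Mapping.lookup f m) * (\<Prod>i\<in>Poly_Mapping.keys m. g i ^ Poly_Mapping.lookup m i))"
  unfolding subst_def using assms by (intro sum.mono_neutral_left) (auto simp: in_keys_iff)

lemma subst_add: "subst g (f + h) = subst g f + subst g h"
proof -
  let ?A = "Poly_Mapping.keys f \<union> Poly_Mapping.keys h"
  have "Poly_Mapping.keys (f + h) \<subseteq> ?A" by (rule keys_add)
  then show ?thesis
    by (simp add: subst_superset[of ?A] lookup_add cst_add distrib_right sum.distrib)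
qed

lemma subst_cst [simp]: "subst g (cst c) = cst c"
  by (cases "c = 0") (simp_all add: subst_def cst_def mult_single)

lemma subst_0 [simp]: "subst g 0 = 0" and subst_1 [simp]: "subst g 1 = 1"
  using subst_cst[of g 0] subst_cst[of g 1] by simp_all

lemma subst_single:
  "subst g (Poly_Mapping.single m c)
     = cst c * (\<Prod>i\<in>Poly_Mapping.keys m. g i ^ Poly_Mapping.lookup m i)"
  by (cases "c = 0") (simp_all add: subst_def)

lemma subst_indet [simp]: "subst g (indet i) = g i"
  by (simp add: indet_def subst_single)

lemma subst_mult: "subst g (f * h) = subst g f * subst g h"
proof -
  have monomials: "subst g (Poly_Mapping.single m c * Poly_Mapping.single n d)
      = subst g (Poly_Mapping.single m c) * subst g (Poly_Mapping.single n d)" for m n c d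
  proof -
    let ?A = "Poly_Mapping.keys m \<union> Poly_Mapping.keys n"
    have superset: "(\<Prod>i\<in>Poly_Mapping.keys k. g i ^ Poly_Mapping.lookup k i)
        = (\<Prod>i\<in>?A. g i ^ Poly_Mapping.lookup k i)" if "Poly_Mapping.keys k \<subseteq> ?A" for k
      using that by (intro prod.mono_neutral_left) (auto simp: in_keys_iff)
    have sub: "Poly_Mapping.keys (m + n) \<subseteq> ?A" by (rule keys_add)
    show ?thesis
      unfolding mult_single subst_single superset[OF sub] superset[OF Un_upper1]
        superset[OF Un_upper2]
      by (simp only: lookup_add power_add prod.distrib cst_mult ac_simps)
  qed
  show ?thesis
  proof (induction f rule: single_add_induct)
    case (single m c)
    show ?case
      by (induction h rule: single_add_induct) (simp_all only: monomials distrib_left subst_add)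
  qed (simp only: distrib_right subst_add)
qed

lemma comm_ring_hom_subst: "comm_ring_hom (subst g)"
  by unfold_locales (simp_all add: subst_add subst_mult)

interpretation subst: comm_ring_hom "subst g" for g
  by (rule comm_ring_hom_subst)

lemmas subst_hom [simp] =
  subst.hom_add subst.hom_mult subst.hom_minus subst.hom_uminus subst.hom_power
  subst.hom_sum subst.hom_prod

lemma subst_numeral [simp]: "subst g (numeral n) = numeral n"
  using subst_cst[of g "numeral n"] by simp

lemma subst_compose: "subst g (subst h f) = subst (\<lambda>i. subst g (h i)) f"
  by (induction f rule: mpoly_induct) simp_all

lemma subst_cong: "f \<in> S l \<Longrightarrow> (\<And>i. i \<le> l \<Longrightarrow> g i = h i) \<Longrightarrow> subst g f = subst h f"
  by (induction rule: S_induct) simp_all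

lemma subst_ident: "subst indet f = f"
  by (induction f rule: mpoly_induct) simp_all

lemma subst_S_ident: "f \<in> S l \<Longrightarrow> (\<And>i. i \<le> l \<Longrightarrow> g i = indet i) \<Longrightarrow> subst g f = f"
  using subst_cong[of f l g indet] by (simp add: subst_ident)

lemma subst_const: "\<exists>c. subst (\<lambda>_. 0) f = cst c"
proof (induction f rule: mpoly_induct)
  case (indet i)
  show ?case by (rule exI[of _ 0]) simp
qed (auto simp flip: cst_add cst_mult)

text \<open>A substitution that moves each indeterminate by a multiple of \<open>a\<close> is the identity modulo
  \<open>a\<close>.\<close>

lemma dvd_diff_subst:
  assumes "\<And>i. a dvd indet i - g i"
  shows "a dvd f - subst g f"
proof (induction f rule: mpoly_induct)
  case (add f h)
  then have "a dvd (f - subst g f) + (h - subst g h)" by (rule dvd_add)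
  then show ?case by (simp add: algebra_simps)
next
  case (mult f h)
  then have "a dvd (f - subst g f) * h + subst g f * (h - subst g h)" by simp
  then show ?case by (simp add: algebra_simps)
qed (use assms in simp_all)

text \<open>The retraction of the whole ring onto \<open>S l\<close> that sends the other indeterminates to \<open>0\<close>.\<close>

definition restr :: "nat \<Rightarrow> mpoly \<Rightarrow> mpoly" where
  "restr l = subst (\<lambda>i. if i \<le> l then indet i else 0)"

lemma restr_in_S: "restr l f \<in> S l"
  unfolding restr_def by (induction f rule: mpoly_induct) (auto intro: S_closed)

lemma restr_ident: "f \<in> S l \<Longrightarrow> restr l f = f"
  unfolding restr_def by (rule subst_S_ident) auto

text \<open>Restricting a quotient to \<open>S l\<close> shows that divisibility relative to \<open>S l\<close> is plain
  divisibility.\<close>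

lemma dvd_in_S_iff:
  assumes "a \<in> S l" "b \<in> S l"
  shows "dvd_in (S l) a b \<longleftrightarrow> a dvd b"
proof
  assume "a dvd b"
  then obtain q where "b = a * q" ..
  then have "restr l b = restr l a * restr l q" by (simp add: restr_def)
  then have "b = a * restr l q" using assms by (simp add: restr_ident)
  then show "dvd_in (S l) a b" using restr_in_S by (auto simp: dvd_in_def)
qed (auto simp: dvd_in_def)

section \<open>Derivations\<close>

lemma partial_superset:
  assumes "finite A" "Poly_Mapping.keys f \<subseteq> A"
  shows "partial i f = (\<Sum>m\<in>A. Poly_Mapping.single (m - Poly_Mapping.single i 1)
       (of_nat (Poly_Mapping.lookup m i) * Poly_Mapping.lookup f m))"
  unfolding partial_def using assms by (intro sum.mono_neutral_left) (auto simp: in_keys_iff)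

lemma partial_add: "partial i (f + g) = partial i f + partial i g"
proof -
  let ?A = "Poly_Mapping.keys f \<union> Poly_Mapping.keys g"
  have "Poly_Mapping.keys (f + g) \<subseteq> ?A" by (rule keys_add)
  then show ?thesis
    by (simp add: partial_superset[of ?A] lookup_add distrib_left single_add sum.distrib)
qed

lemma partial_single: "partial i (Poly_Mapping.single m c)
    = Poly_Mapping.single (m - Poly_Mapping.single i 1) (of_nat (Poly_Mapping.lookup m i) * c)"
  by (cases "c = 0") (simp_all add: partial_def)

lemma partial_cst [simp]: "partial i (cst c) = 0"
  by (simp add: cst_def partial_single)

lemma partial_indet [simp]: "partial i (indet k) = (if i = k then 1 else 0)"
  by (simp add: indet_def partial_single lookup_single)

lemma partial_mult: "partial i (f * g) = partial i f * g + f * partial i g"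
proof -
  let ?e = "Poly_Mapping.single i 1 :: nat \<Rightarrow>\<^sub>0 nat"
  have shift: "Poly_Mapping.single (m + n - ?e) (of_nat (Poly_Mapping.lookup m i) * c :: real)
      = Poly_Mapping.single (m - ?e + n) (of_nat (Poly_Mapping.lookup m i) * c)" for m n c
  proof (cases "Poly_Mapping.lookup m i = 0")
    case False
    \<comment> \<open>the truncated subtraction has no effect, since \<open>m\<close> has exponent at least \<open>1\<close> at \<open>i\<close>\<close>
    then have "m + n - ?e = m - ?e + n"
      by (intro poly_mapping_eqI) (auto simp: lookup_add lookup_minus lookup_single when_def)
    then show ?thesis by simp
  qed simp
  have monomials: "partial i (Poly_Mapping.single m c * Poly_Mapping.single n d)
      = partial i (Poly_Mapping.single m c) * Poly_Mapping.single n d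
        + Poly_Mapping.single m c * partial i (Poly_Mapping.single n d)" for m n and c d :: real
  proof -
    have "partial i (Poly_Mapping.single m c * Poly_Mapping.single n d)
        = Poly_Mapping.single (m + n - ?e) (of_nat (Poly_Mapping.lookup m i) * (c * d))
          + Poly_Mapping.single (n + m - ?e) (of_nat (Poly_Mapping.lookup n i) * (c * d))"
      by (simp add: mult_single partial_single lookup_add distrib_right single_add add.commute)
    then show ?thesis
      unfolding shift by (simp add: partial_single mult_single ac_simps)
  qed
  show ?thesis
  proof (induction f rule: single_add_induct)
    case (single m c)
    show ?case
      by (induction g rule: single_add_induct)
         (simp_all only: monomials distrib_left partial_add add_ac)
  qed (simp only: distrib_right partial_add add_ac)
qed

lemma partial_in_S:
  assumes "f \<in> S l"
  shows "partial i f \<in> S l"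
  using assms
proof (induction rule: S_induct)
  case (indet k)
  then show ?case by (simp add: S_0 S_1)
qed (simp_all add: S_closed partial_add partial_mult)

text \<open>The derivation of \<open>S l\<close> with prescribed values on the indeterminates.\<close>

definition der :: "nat \<Rightarrow> (nat \<Rightarrow> mpoly) \<Rightarrow> mpoly \<Rightarrow> mpoly" where
  "der l a = (\<lambda>f \<in> S l. \<Sum>i=0..l. a i * partial i f)"

lemma der_in_Der:
  assumes "\<And>i. i \<le> l \<Longrightarrow> a i \<in> S l"
  shows "der l a \<in> Der l"
proof -
  have "der l a \<in> S l \<rightarrow>\<^sub>E S l"
    using assms by (auto simp: der_def intro!: S_sum S_mult partial_in_S)
  then show ?thesis
    by (simp add: Der_def der_def S_closed partial_add partial_mult sum.distrib sum_distrib_left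
        sum_distrib_right algebra_simps)
qed

lemma der_indet: "i \<le> l \<Longrightarrow> der l a (indet i) = a i"
  by (simp add: der_def S_indet if_distrib[of "(*) _"] cong: if_cong)

lemma Der_S: "\<theta> \<in> Der l \<Longrightarrow> f \<in> S l \<Longrightarrow> \<theta> f \<in> S l"
  and Der_add: "\<theta> \<in> Der l \<Longrightarrow> f \<in> S l \<Longrightarrow> g \<in> S l \<Longrightarrow> \<theta> (f + g) = \<theta> f + \<theta> g"
  and Der_scale: "\<theta> \<in> Der l \<Longrightarrow> f \<in> S l \<Longrightarrow> \<theta> (cst c * f) = cst c * \<theta> f"
  and Der_mult: "\<theta> \<in> Der l \<Longrightarrow> f \<in> S l \<Longrightarrow> g \<in> S l \<Longrightarrow> \<theta> (f * g) = \<theta> f * g + f * \<theta> g"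
  by (auto simp: Der_def)

lemma Der_diff: "\<theta> \<in> Der l \<Longrightarrow> f \<in> S l \<Longrightarrow> g \<in> S l \<Longrightarrow> \<theta> (f - g) = \<theta> f - \<theta> g"
  using Der_add[of \<theta> l f "- g"] Der_scale[of \<theta> l g "-1"] by (simp add: cst_uminus S_uminus)

lemma Der_cst:
  assumes "\<theta> \<in> Der l"
  shows "\<theta> (cst c) = 0"
  using Der_mult[OF assms S_1 S_1] Der_scale[OF assms S_1, of c] by simp

lemma Der_eqI:
  assumes "\<theta> \<in> Der l" "\<eta> \<in> Der l" "\<And>i. i \<le> l \<Longrightarrow> \<theta> (indet i) = \<eta> (indet i)"
  shows "\<theta> = \<eta>"
proof
  fix f
  show "\<theta> f = \<eta> f"
  proof (cases "f \<in> S l")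
    case True
    then show ?thesis
      by (induction rule: S_induct)
         (use assms in \<open>simp_all add: Der_cst Der_add Der_mult\<close>)
  next
    case False
    then show ?thesis using assms(1,2) by (auto simp: Der_def PiE_def extensional_def)
  qed
qed

section \<open>Homogenization and the Bernoulli-type polynomials\<close>

text \<open>The homogenization \<open>z\<^bsup>n\<^esup> p(u/z)\<close> of a real polynomial of degree at most \<open>n\<close>.\<close>

definition homg :: "nat \<Rightarrow> real poly \<Rightarrow> mpoly \<Rightarrow> mpoly" where
  "homg n p u = (\<Sum>k\<le>n. cst (coeff p k) * u ^ k * Z ^ (n - k))"

lemma B_bar_eq_homg: "B_bar r s u = homg (r + 2 * s) (B_C r s) u"
  by (simp add: B_bar_def homg_def)

lemma homg_add: "homg n (p + q) u = homg n p u + homg n q u"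
  by (simp add: homg_def cst_add distrib_right sum.distrib)

lemma homg_uminus: "homg n (- p) u = - homg n p u"
  by (simp add: homg_def cst_uminus sum_negf)

lemma homg_diff: "homg n (p - q) u = homg n p u - homg n q u"
  using homg_add[of n p "- q" u] by (simp add: homg_uminus)

lemma homg_smult: "homg n (Polynomial.smult c p) u = cst c * homg n p u"
  by (simp add: homg_def cst_mult sum_distrib_left mult.assoc)

lemma homg_0: "homg n 0 u = 0"
  by (simp add: homg_def)

lemma homg_sum: "homg n (\<Sum>i\<in>A. f i) u = (\<Sum>i\<in>A. homg n (f i) u)"
  by (induction A rule: infinite_finite_induct) (simp_all add: homg_add homg_0)

lemma homg_monom: "i \<le> n \<Longrightarrow> homg n (Polynomial.monom a i) u = cst a * u ^ i * Z ^ (n - i)"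
  by (simp add: homg_def if_distrib[of cst] if_distrib[of "\<lambda>x. x * _"] cong: if_cong)

lemma homg_1: "homg n 1 u = Z ^ n"
  using homg_monom[of 0 n 1 u] by simp

lemma homg_linear: "homg 1 [:a, b:] u = cst a * Z + cst b * u"
  by (simp add: homg_def algebra_simps)

lemma homg_mult:
  assumes "degree p \<le> m" "degree q \<le> n"
  shows "homg (m + n) (p * q) u = homg m p u * homg n q u"
proof -
  have "p * q = (\<Sum>i\<le>m. Polynomial.monom (coeff p i) i) * (\<Sum>j\<le>n. Polynomial.monom (coeff q j) j)"
    using assms by (simp add: poly_as_sum_of_monoms')
  also have "\<dots> = (\<Sum>i\<le>m. \<Sum>j\<le>n. Polynomial.monom (coeff p i * coeff q j) (i + j))"
    by (simp add: sum_product mult_monom)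
  finally have "homg (m + n) (p * q) u = (\<Sum>i\<le>m. \<Sum>j\<le>n.
      cst (coeff p i * coeff q j) * u ^ (i + j) * Z ^ (m + n - (i + j)))"
    by (simp add: homg_sum homg_monom)
  also have "\<dots> = (\<Sum>i\<le>m. \<Sum>j\<le>n. (cst (coeff p i) * u ^ i * Z ^ (m - i))
      * (cst (coeff q j) * u ^ j * Z ^ (n - j)))"
  proof (intro sum.cong refl)
    fix i j assume "i \<in> {..m}" "j \<in> {..n}"
    then have "m + n - (i + j) = (m - i) + (n - j)" by auto
    then show "cst (coeff p i * coeff q j) * u ^ (i + j) * Z ^ (m + n - (i + j))
      = (cst (coeff p i) * u ^ i * Z ^ (m - i)) * (cst (coeff q j) * u ^ j * Z ^ (n - j))"
      by (simp add: cst_mult power_add)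
  qed
  also have "\<dots> = homg m p u * homg n q u"
    by (simp add: homg_def sum_product)
  finally show ?thesis .
qed

lemma homg_Suc: "degree p \<le> n \<Longrightarrow> homg (Suc n) p u = Z * homg n p u"
  using homg_mult[of 1 1 p n u] by (simp add: homg_1)

lemma homg_power:
  assumes "degree p \<le> 1"
  shows "homg k (p ^ k) u = homg 1 p u ^ k"
proof (induction k)
  case (Suc k)
  have "degree (p ^ k) \<le> degree p * k" by (rule degree_power_le)
  also have "\<dots> \<le> k" using assms by simp
  finally show ?case using homg_mult[of p 1 "p ^ k" k u] assms Suc by simp
qed (simp add: homg_1)

lemma homg_pcompose_linear:
  assumes p: "degree p \<le> n" and q: "degree q \<le> 1"
  shows "homg n (pcompose p q) u = homg n p (homg 1 q u)"
proof -
  have power: "homg n (q ^ i) u = homg 1 q u ^ i * Z ^ (n - i)" if "i \<le> n" for i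
  proof -
    have "degree (q ^ i) \<le> degree q * i" by (rule degree_power_le)
    also have "\<dots> \<le> i" using q by simp
    finally show ?thesis
      using homg_mult[of "q ^ i" i 1 "n - i" u] that
      by (simp add: homg_1 homg_power[OF q])
  qed
  have pcompose_X_power: "pcompose ([:0, 1:] ^ i) q = q ^ i" for i
    by (induction i) (simp_all add: pcompose_mult pcompose_pCons pcompose_1)
  have "pcompose p q = pcompose (\<Sum>i\<le>n. Polynomial.monom (coeff p i) i) q"
    using p by (simp add: poly_as_sum_of_monoms')
  also have "\<dots> = (\<Sum>i\<le>n. Polynomial.smult (coeff p i) (q ^ i))"
    by (simp add: pcompose_sum monom_altdef pcompose_smult pcompose_X_power)
  finally show ?thesis
    by (simp add: homg_sum homg_smult power) (simp add: homg_def mult.assoc)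
qed

lemma B_C_difference:
  assumes "r \<ge> 1"
  shows "pcompose (B_C r s) [:1, 1:] - B_C r s
    = ([:1, 1:] ^ (r - 1) + [:0, -1:] ^ (r - 1)) * [:1, 1:] ^ s * [:0, -1:] ^ s"
  using B_C_spec(1)[OF assms, of s]
  by (intro poly_eq_poly_eq_iff[THEN iffD1] ext)
     (simp add: B_spec_def poly_pcompose poly_power add.commute)

text \<open>The right-hand side of the difference equation is invariant under \<open>t \<mapsto> -1 - t\<close>, so
  \<open>t \<mapsto> - B(- t)\<close> solves it as well.\<close>

lemma B_C_odd:
  assumes "r \<ge> 1"
  shows "pcompose (B_C r s) [:0, -1:] = - B_C r s"
proof -
  have spec: "poly (B_C r s) 0 = 0" "\<And>t. poly (B_C r s) (t + 1) - poly (B_C r s) t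
      = ((t + 1) ^ (r - 1) + (- t) ^ (r - 1)) * (t + 1) ^ s * (- t) ^ s"
    using B_C_spec(1)[OF assms, of s] by (auto simp: B_spec_def)
  have "B_spec r s (- pcompose (B_C r s) [:0, -1:])"
    unfolding B_spec_def
  proof (intro conjI allI)
    fix t
    show "poly (- pcompose (B_C r s) [:0, -1:]) (t + 1) - poly (- pcompose (B_C r s) [:0, -1:]) t
      = ((t + 1) ^ (r - 1) + (- t) ^ (r - 1)) * (t + 1) ^ s * (- t) ^ s"
      \<comment> \<open>the reflection exchanges \<open>t + 1\<close> and \<open>- t\<close>\<close>
      using spec(2)[of "- 1 - t"] by (simp add: poly_pcompose algebra_simps)
  qed (simp add: poly_pcompose spec(1))
  then have "- pcompose (B_C r s) [:0, -1:] = B_C r s"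
    using B_C_spec(1)[OF assms] B_spec_unique by blast
  then show ?thesis by (metis minus_minus)
qed

lemma B_bar_minus: "r \<ge> 1 \<Longrightarrow> B_bar r s (- u) = - B_bar r s u"
  using homg_pcompose_linear[of "B_C r s" "r + 2 * s" "[:0, -1:]" u] B_C_spec(2)[of r s]
  by (simp add: B_bar_eq_homg B_C_odd homg_uminus homg_linear[simplified] cst_uminus)

lemma B_bar_difference:
  assumes "r \<ge> 1"
  shows "B_bar r s (u + Z) - B_bar r s u
    = Z * ((u + Z) ^ (r - 1) + (- u) ^ (r - 1)) * ((u + Z) * (- u)) ^ s"
proof -
  let ?a = "[:1, 1:] :: real poly" and ?b = "[:0, -1:] :: real poly"
  have deg: "degree (?a ^ k) \<le> k" "degree (?b ^ k) \<le> k" for k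
    by (rule order_trans[OF degree_power_le]; simp)+
  have a: "homg k (?a ^ k) u = (u + Z) ^ k" for k
    using homg_power[of ?a k u] homg_linear[of 1 1 u] by (simp add: add.commute)
  have b: "homg k (?b ^ k) u = (- u) ^ k" for k
    using homg_power[of ?b k u] homg_linear[of 0 "-1" u] by (simp add: cst_uminus)
  have deg_ab: "degree (?a ^ (r - 1) + ?b ^ (r - 1)) \<le> r - 1"
    by (intro degree_add_le deg)
  have deg_abs: "degree ((?a ^ (r - 1) + ?b ^ (r - 1)) * ?a ^ s) \<le> r - 1 + s"
    by (intro order_trans[OF degree_mult_le] add_mono deg_ab deg)
  have "B_bar r s (u + Z) - B_bar r s u
      = homg (r + 2 * s) (pcompose (B_C r s) ?a - B_C r s) u"
    using homg_pcompose_linear[of "B_C r s" "r + 2 * s" ?a u] B_C_spec(2)[OF assms, of s]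
      homg_linear[of 1 1 u]
    by (simp add: B_bar_eq_homg homg_diff add.commute)
  also have "\<dots> = homg (Suc (r - 1 + s + s)) ((?a ^ (r - 1) + ?b ^ (r - 1)) * ?a ^ s * ?b ^ s) u"
    using assms by (simp add: B_C_difference mult_2 add.assoc)
  also have "\<dots> = Z * homg (r - 1 + s + s) ((?a ^ (r - 1) + ?b ^ (r - 1)) * ?a ^ s * ?b ^ s) u"
    by (intro homg_Suc order_trans[OF degree_mult_le] add_mono deg_abs deg)
  also have "homg (r - 1 + s + s) ((?a ^ (r - 1) + ?b ^ (r - 1)) * ?a ^ s * ?b ^ s) u
      = ((u + Z) ^ (r - 1) + (- u) ^ (r - 1)) * (u + Z) ^ s * (- u) ^ s"
    by (simp only: homg_mult deg deg_ab deg_abs homg_add a b)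
  finally show ?thesis by (simp only: power_mult_distrib mult.assoc)
qed

section \<open>Generating-function identities\<close>

text \<open>Each factor \<open>a\<^sub>t + b\<^sub>t + c\<close> contributes \<open>a\<^sub>t\<close> for \<open>t \<in> N\<^sub>1\<close>, \<open>b\<^sub>t\<close> for \<open>t \<in> N\<^sub>2\<close>, and \<open>c\<close> for
  the remaining \<open>t\<close>.\<close>

lemma sum_disjoint_pairs:
  fixes a b :: "'i \<Rightarrow> 'a::comm_ring_1"
  assumes "finite A"
  shows "(\<Sum>(N1, N2)\<in>{(N1, N2). N1 \<subseteq> A \<and> N2 \<subseteq> A \<and> N1 \<inter> N2 = {}}.
      prod a N1 * prod b N2 * c ^ (card A - card N1 - card N2)) = (\<Prod>t\<in>A. a t + b t + c)"
proof -
  have pairs: "{(N1, N2). N1 \<subseteq> A \<and> N2 \<subseteq> A \<and> N1 \<inter> N2 = {}} = Sigma (Pow A) (\<lambda>N1. Pow (A - N1))"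
    by auto
  have "(\<Prod>t\<in>A. a t + b t + c) = (\<Sum>N1\<in>Pow A. prod a N1 * (\<Prod>t\<in>A - N1. b t + c))"
    using prod_add[OF assms, of a "\<lambda>t. b t + c"] by (simp add: add.assoc)
  also have "\<dots> = (\<Sum>N1\<in>Pow A. \<Sum>N2\<in>Pow (A - N1).
      prod a N1 * prod b N2 * c ^ (card A - card N1 - card N2))"
  proof (intro sum.cong refl)
    fix N1 assume "N1 \<in> Pow A"
    have "c ^ card (A - N1 - N2) = c ^ (card A - card N1 - card N2)" if "N2 \<in> Pow (A - N1)" for N2
      using that \<open>N1 \<in> Pow A\<close> assms by (simp add: card_Diff_subset finite_subset)
    then show "prod a N1 * (\<Prod>t\<in>A - N1. b t + c) = (\<Sum>N2\<in>Pow (A - N1).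
        prod a N1 * prod b N2 * c ^ (card A - card N1 - card N2))"
      using assms by (simp add: prod_add sum_distrib_left mult.assoc)
  qed
  also have "\<dots> = (\<Sum>(N1, N2)\<in>Sigma (Pow A) (\<lambda>N1. Pow (A - N1)).
      prod a N1 * prod b N2 * c ^ (card A - card N1 - card N2))"
    using assms by (subst sum.Sigma) auto
  finally show ?thesis by (simp add: pairs)
qed

lemma sum_esym:
  assumes "finite A"
  shows "(\<Sum>k=0..card A. (- 1) ^ k * esym k A f * y ^ (card A - k)) = (\<Prod>t\<in>A. y - f t)"
proof -
  have "(\<Prod>t\<in>A. y - f t) = (\<Prod>t\<in>A. - f t + y)" by simp
  also have "\<dots> = (\<Sum>T\<in>Pow A. (\<Prod>t\<in>T. - f t) * y ^ card (A - T))"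
    using prod_add[OF assms, of "\<lambda>t. - f t" "\<lambda>_. y"] by simp
  also have "\<dots> = (\<Sum>T\<in>Pow A. (- 1) ^ card T * (\<Prod>t\<in>T. f t) * y ^ (card A - card T))"
    using assms by (intro sum.cong) (auto simp: prod_uminus card_Diff_subset finite_subset)
  also have "\<dots> = (\<Sum>k=0..card A. \<Sum>T | T \<in> Pow A \<and> card T = k.
      (- 1) ^ card T * (\<Prod>t\<in>T. f t) * y ^ (card A - card T))"
    using assms by (intro sum.group[symmetric]) (auto intro: card_mono)
  also have "\<dots> = (\<Sum>k=0..card A. (- 1) ^ k * esym k A f * y ^ (card A - k))"
    by (intro sum.cong refl) (auto simp: esym_def sum_distrib_left sum_distrib_right)
  finally show ?thesis by simp
qed

section \<open>The polynomials interpolating the coefficients\<close>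

text \<open>The common coefficient polynomial of the \<open>j\<close>-th derivation: its \<open>i\<close>-th coefficient is,
  up to the sign \<open>(-1)\<^sup>j\<close>, the value at \<open>u = x\<^sub>i\<close>.\<close>

definition phi_poly :: "nat \<Rightarrow> nat \<Rightarrow> mpoly \<Rightarrow> mpoly" where
  "phi_poly l j u =
     (\<Sum>(N1, N2) \<in> {(N1, N2). N1 \<subseteq> {1..<j} \<and> N2 \<subseteq> {1..<j} \<and> N1 \<inter> N2 = {}}.
        (\<Prod>t\<in>N1. (X t)\<^sup>2) * (\<Prod>t\<in>N2. - (X t * Z)) *
        (\<Sum>k2=0..1. \<Sum>k3=0..l - j.
           (- 1) ^ (k2 + k3) * esym k2 {j} X * esym k3 {j+1..l} (\<lambda>t. (X t)\<^sup>2) *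
           B_bar (2 * l + 2 - 2 * j - k2 - 2 * k3) ((j - 1) - card N1 - card N2) u))"

lemma phi_coeff_eq: "phi_coeff l j i = phi_poly l j (X i)"
  by (simp only: phi_coeff_def phi_poly_def)

lemma phi_index_bound: "1 \<le> j \<Longrightarrow> j \<le> l \<Longrightarrow> k2 \<le> 1 \<Longrightarrow> k3 \<le> l - j \<Longrightarrow>
    1 \<le> 2 * l + 2 - 2 * j - k2 - 2 * (k3::nat)"
  by linarith

text \<open>The sum over \<open>k\<^sub>2\<close> and \<open>k\<^sub>3\<close>, with the Bernoulli-type polynomial replaced by \<open>y\<^bsup>r-1\<^esup>\<close>, in factored
  form. The difference of \<^term>\<open>phi_poly l j\<close> contains its values at \<open>y = u + z\<close> and \<open>y = - u\<close>.\<close>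

definition phi_tail :: "nat \<Rightarrow> nat \<Rightarrow> mpoly \<Rightarrow> mpoly" where
  "phi_tail l j y = (y - X j) * (\<Prod>t=j+1..l. y\<^sup>2 - (X t)\<^sup>2)"

lemma phi_tail_eq_sum:
  assumes "1 \<le> j" "j \<le> l"
  shows "phi_tail l j y = (\<Sum>k2=0..1. \<Sum>k3=0..l - j.
    (- 1) ^ (k2 + k3) * esym k2 {j} X * esym k3 {j+1..l} (\<lambda>t. (X t)\<^sup>2) *
      y ^ (2 * l + 2 - 2 * j - k2 - 2 * k3 - 1))"
proof -
  have "phi_tail l j y = (\<Sum>k2=0..1. (- 1) ^ k2 * esym k2 {j} X * y ^ (1 - k2)) *
      (\<Sum>k3=0..l-j. (- 1) ^ k3 * esym k3 {j+1..l} (\<lambda>t. (X t)\<^sup>2) * (y\<^sup>2) ^ (l - j - k3))"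
    using sum_esym[of "{j}" X y] sum_esym[of "{j+1..l}" "\<lambda>t. (X t)\<^sup>2" "y\<^sup>2"]
    by (simp add: phi_tail_def)
  also have "\<dots> = (\<Sum>k2=0..1. \<Sum>k3=0..l - j.
      (- 1) ^ (k2 + k3) * esym k2 {j} X * esym k3 {j+1..l} (\<lambda>t. (X t)\<^sup>2) *
        y ^ (2 * l + 2 - 2 * j - k2 - 2 * k3 - 1))"
    unfolding sum_product
  proof (intro sum.cong refl)
    fix k2 k3 assume "k2 \<in> {0..1::nat}" "k3 \<in> {0..l - j}"
    then have "2 * l + 2 - 2 * j - k2 - 2 * k3 - 1 = (1 - k2) + 2 * (l - j - k3)"
      using assms by auto
    then show "(- 1) ^ k2 * esym k2 {j} X * y ^ (1 - k2) *
        ((- 1) ^ k3 * esym k3 {j+1..l} (\<lambda>t. (X t)\<^sup>2) * (y\<^sup>2) ^ (l - j - k3))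
      = (- 1) ^ (k2 + k3) * esym k2 {j} X * esym k3 {j+1..l} (\<lambda>t. (X t)\<^sup>2) *
        y ^ (2 * l + 2 - 2 * j - k2 - 2 * k3 - 1)"
      by (simp add: power_add power_mult)
  qed
  finally show ?thesis .
qed

lemma phi_poly_difference:
  assumes "1 \<le> j" "j \<le> l"
  shows "phi_poly l j (u + Z) - phi_poly l j u
    = Z * (\<Prod>t=1..<j. (X t + u) * (X t - u - Z)) * (phi_tail l j (u + Z) + phi_tail l j (- u))"
proof -
  let ?D = "{(N1, N2). N1 \<subseteq> {1..<j} \<and> N2 \<subseteq> {1..<j} \<and> N1 \<inter> N2 = {}}"
  let ?c = "\<lambda>k2 k3. (- 1) ^ (k2 + k3) * esym k2 {j} X * esym k3 {j+1..l} (\<lambda>t. (X t)\<^sup>2)"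
  let ?r = "\<lambda>k2 k3. 2 * l + 2 - 2 * j - k2 - 2 * k3"
  let ?w = "(u + Z) * (- u)"
  have inner: "(\<Sum>k2=0..1. \<Sum>k3=0..l-j. ?c k2 k3 * B_bar (?r k2 k3) s (u + Z))
      - (\<Sum>k2=0..1. \<Sum>k3=0..l-j. ?c k2 k3 * B_bar (?r k2 k3) s u)
      = Z * ?w ^ s * (phi_tail l j (u + Z) + phi_tail l j (- u))" for s
  proof -
    have "(\<Sum>k2=0..1. \<Sum>k3=0..l-j. ?c k2 k3 * B_bar (?r k2 k3) s (u + Z))
        - (\<Sum>k2=0..1. \<Sum>k3=0..l-j. ?c k2 k3 * B_bar (?r k2 k3) s u)
      = (\<Sum>k2=0..1. \<Sum>k3=0..l-j. ?c k2 k3 *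
          (B_bar (?r k2 k3) s (u + Z) - B_bar (?r k2 k3) s u))"
      by (simp only: right_diff_distrib sum_subtractf)
    also have "\<dots> = (\<Sum>k2=0..1. \<Sum>k3=0..l-j. Z * ?w ^ s * (?c k2 k3 * (u + Z) ^ (?r k2 k3 - 1)
        + ?c k2 k3 * (- u) ^ (?r k2 k3 - 1)))"
    proof (intro sum.cong refl)
      fix k2 k3 assume "k2 \<in> {0..1::nat}" "k3 \<in> {0..l - j}"
      then have "1 \<le> ?r k2 k3" using assms by (intro phi_index_bound) auto
      then show "?c k2 k3 * (B_bar (?r k2 k3) s (u + Z) - B_bar (?r k2 k3) s u)
        = Z * ?w ^ s * (?c k2 k3 * (u + Z) ^ (?r k2 k3 - 1) + ?c k2 k3 * (- u) ^ (?r k2 k3 - 1))"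
        by (simp only: B_bar_difference) (simp only: algebra_simps)
    qed
    also have "\<dots> = Z * ?w ^ s * (phi_tail l j (u + Z) + phi_tail l j (- u))"
      by (simp only: phi_tail_eq_sum[OF assms] sum.distrib sum_distrib_left distrib_left)
    finally show ?thesis .
  qed
  have "phi_poly l j (u + Z) - phi_poly l j u = (\<Sum>(N1, N2)\<in>?D.
      (\<Prod>t\<in>N1. (X t)\<^sup>2) * (\<Prod>t\<in>N2. - (X t * Z)) *
      ((\<Sum>k2=0..1. \<Sum>k3=0..l-j. ?c k2 k3 * B_bar (?r k2 k3) (j - 1 - card N1 - card N2) (u + Z))
      - (\<Sum>k2=0..1. \<Sum>k3=0..l-j. ?c k2 k3 * B_bar (?r k2 k3) (j - 1 - card N1 - card N2) u)))"
    by (simp only: phi_poly_def right_diff_distrib case_prod_unfold sum_subtractf)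
  also have "\<dots> = (\<Sum>(N1, N2)\<in>?D. (\<Prod>t\<in>N1. (X t)\<^sup>2) * (\<Prod>t\<in>N2. - (X t * Z)) *
      ?w ^ (card {1..<j} - card N1 - card N2))
      * (Z * (phi_tail l j (u + Z) + phi_tail l j (- u)))"
    unfolding inner sum_distrib_right
    by (intro sum.cong refl) (simp add: case_prod_unfold mult.assoc mult.left_commute)
  also have "\<dots> = (\<Prod>t\<in>{1..<j}. (X t)\<^sup>2 + - (X t * Z) + ?w)
      * (Z * (phi_tail l j (u + Z) + phi_tail l j (- u)))"
    by (subst sum_disjoint_pairs) simp_all
  also have "(\<Prod>t\<in>{1..<j}. (X t)\<^sup>2 + - (X t * Z) + ?w) = (\<Prod>t=1..<j. (X t + u) * (X t - u - Z))"
    by (intro prod.cong refl) (simp add: algebra_simps power2_eq_square)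
  finally show ?thesis by (simp only: mult_ac)
qed

lemma phi_poly_minus:
  assumes "1 \<le> j" "j \<le> l"
  shows "phi_poly l j (- u) = - phi_poly l j u"
proof -
  have B_minus: "B_bar (2 * l + 2 - 2 * j - k2 - 2 * k3) s (- u)
      = - B_bar (2 * l + 2 - 2 * j - k2 - 2 * k3) s u"
    if "k2 \<in> {0..1}" "k3 \<in> {0..l - j}" for k2 k3 s
    using that assms by (intro B_bar_minus phi_index_bound) auto
  let ?c = "\<lambda>k2 k3. (- 1) ^ (k2 + k3) * esym k2 {j} X * esym k3 {j+1..l} (\<lambda>t. (X t)\<^sup>2)"
  have "(\<Sum>k2=0..1. \<Sum>k3=0..l - j. ?c k2 k3 * B_bar (2 * l + 2 - 2 * j - k2 - 2 * k3) s (- u))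
      = (\<Sum>k2=0..1. \<Sum>k3=0..l - j. - (?c k2 k3 * B_bar (2 * l + 2 - 2 * j - k2 - 2 * k3) s u))"
    for s
    by (intro sum.cong refl) (simp only: B_minus mult_minus_right)
  then show ?thesis
    by (simp only: phi_poly_def case_prod_unfold sum_negf mult_minus_right)
qed

lemma phi_poly_0:
  assumes "1 \<le> j" "j \<le> l"
  shows "phi_poly l j 0 = 0"
proof -
  have "2 * phi_poly l j 0 = 0"
    using phi_poly_minus[OF assms, of 0] by (simp add: mult_2 eq_neg_iff_add_eq_0)
  then show ?thesis by simp
qed

lemma polynomial_function_sum:
  fixes F :: "'k \<Rightarrow> 'a::comm_ring_1 \<Rightarrow> 'a"
  assumes "\<And>k. k \<in> A \<Longrightarrow> \<exists>p. degree p \<le> n \<and> (\<forall>u. F k u = poly p u)"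
  shows "\<exists>p. degree p \<le> n \<and> (\<forall>u. (\<Sum>k\<in>A. F k u) = poly p u)"
proof -
  have "\<forall>k\<in>A. \<exists>p. degree p \<le> n \<and> (\<forall>u. F k u = poly p u)"
    using assms by blast
  from bchoice[OF this] obtain p
    where "\<forall>k\<in>A. degree (p k) \<le> n \<and> (\<forall>u. F k u = poly (p k) u)" by blast
  then have "degree (\<Sum>k\<in>A. p k) \<le> n" "(\<Sum>k\<in>A. F k u) = poly (\<Sum>k\<in>A. p k) u" for u
    by (cases "finite A"; force intro: degree_sum_le sum.cong simp: poly_sum)+
  then show ?thesis by blast
qed

lemma polynomial_function_scale:
  fixes F :: "'a::comm_ring_1 \<Rightarrow> 'a"
  assumes "\<exists>p. degree p \<le> n \<and> (\<forall>u. F u = poly p u)"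
  shows "\<exists>p. degree p \<le> n \<and> (\<forall>u. c * F u = poly p u)"
proof -
  from assms obtain p where p: "degree p \<le> n" "\<And>u. F u = poly p u" by blast
  then have "degree (Polynomial.smult c p) \<le> n" by (auto intro: order_trans[OF degree_smult_le])
  with p(2) show ?thesis by (intro exI[of _ "Polynomial.smult c p"]) simp
qed

lemma B_bar_polynomial:
  assumes "r + 2 * s \<le> n"
  shows "\<exists>p. degree p \<le> n \<and> (\<forall>u. B_bar r s u = poly p u)"
proof -
  have "\<exists>p. degree p \<le> n \<and> (\<forall>u. cst (coeff (B_C r s) k) * u ^ k * Z ^ (r + 2 * s - k) = poly p u)"
    if "k \<in> {..r + 2 * s}" for k
  proof (intro exI[of _ "Polynomial.monom (cst (coeff (B_C r s) k) * Z ^ (r + 2 * s - k)) k"] conjI)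
    show "degree (Polynomial.monom (cst (coeff (B_C r s) k) * Z ^ (r + 2 * s - k)) k) \<le> n"
      using that assms by (auto intro: order_trans[OF degree_monom_le])
  qed (simp add: poly_monom)
  then show ?thesis unfolding B_bar_def by (rule polynomial_function_sum)
qed

text \<open>As a function of \<open>u\<close>, \<^term>\<open>phi_poly l j\<close> is a univariate polynomial over the whole
  ring, of degree at most \<open>2l\<close>.\<close>

lemma phi_poly_polynomial:
  assumes "1 \<le> j" "j \<le> l"
  shows "\<exists>p. degree p \<le> 2 * l \<and> (\<forall>u. phi_poly l j u = poly p u)"
  unfolding phi_poly_def case_prod_unfold
proof (intro polynomial_function_sum polynomial_function_scale B_bar_polynomial)
  fix N k2 k3 assume "k2 \<in> {0..1::nat}" "k3 \<in> {0..l - j}"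
  then show "2 * l + 2 - 2 * j - k2 - 2 * k3 + 2 * (j - 1 - card (fst N) - card (snd N)) \<le> 2 * l"
    using assms by simp
qed

lemma diff_dvd_poly_diff: "x - y dvd poly p x - poly p (y :: 'a::comm_ring_1)"
proof (induction p)
  case (pCons a p)
  have "poly (pCons a p) x - poly (pCons a p) y
      = x * (poly p x - poly p y) + (x - y) * poly p y"
    by (simp add: algebra_simps)
  then show ?case using pCons by simp
qed simp

lemma phi_poly_cong:
  assumes "1 \<le> j" "j \<le> l"
  shows "u - v dvd phi_poly l j u - phi_poly l j v"
  using phi_poly_polynomial[OF assms] diff_dvd_poly_diff[of u v] by metis

lemma esym_in_S: "(\<And>i. i \<in> A \<Longrightarrow> f i \<in> S l) \<Longrightarrow> esym k A f \<in> S l"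
  unfolding esym_def by (auto intro!: S_sum S_prod)

lemma phi_poly_in_S:
  assumes "j \<le> l" "u \<in> S l"
  shows "phi_poly l j u \<in> S l"
proof -
  have "- 1 \<in> S l" by (intro S_closed)
  moreover have "(\<Prod>t\<in>N. (X t)\<^sup>2) \<in> S l" "(\<Prod>t\<in>N. - (X t * Z)) \<in> S l" if "N \<subseteq> {1..<j}" for N
    using that assms by (auto intro!: S_prod S_power S_uminus S_mult S_indet)
  moreover have "esym k2 {j} X \<in> S l" "esym k3 {j+1..l} (\<lambda>t. (X t)\<^sup>2) \<in> S l" for k2 k3
    using assms by (auto intro!: esym_in_S S_power S_indet)
  moreover have "B_bar r s u \<in> S l" for r s
    unfolding B_bar_def using assms by (intro S_closed) auto
  ultimately show ?thesis
    unfolding phi_poly_def case_prod_unfold by (intro S_sum S_mult S_power) auto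
qed

section \<open>Membership in the derivation module\<close>

text \<open>The congruence behind membership: on the hyperplane \<open>x\<^sub>p = u + \<delta> z\<close>, where \<open>u = \<plusminus> x\<^sub>q\<close>, the
  values at \<open>x\<^sub>p\<close> and \<open>u\<close> agree: for \<open>\<delta> = 1\<close>, some factor of each summand of the difference
  vanishes.\<close>

lemma phi_poly_hyperplane:
  assumes j: "1 \<le> j" "j \<le> l" and pq: "1 \<le> p" "p \<le> q" "q \<le> l"
    and u: "u = X q \<and> p \<noteq> q \<or> u = - X q"
  shows "X p - u - of_bool d * Z dvd phi_poly l j (X p) - phi_poly l j u"
proof (cases d)
  case True
  let ?a = "X p - (u + Z)"
  have "?a dvd (\<Prod>t=1..<j. (X t + u) * (X t - u - Z))" if "p < j"
  proof -
    have "(X p + u) * (X p - u - Z) dvd (\<Prod>t=1..<j. (X t + u) * (X t - u - Z))"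
      using that pq by (intro dvd_prodI) auto
    moreover have "?a dvd (X p + u) * (X p - u - Z)" by (simp add: diff_diff_eq)
    ultimately show ?thesis by (rule dvd_trans[rotated])
  qed
  moreover have "?a dvd phi_tail l j (u + Z)" if "j \<le> p"
  proof (cases "j = p")
    case True
    have "?a dvd u + Z - X p" by (subst dvd_minus_iff[symmetric]) simp
    then show ?thesis by (simp add: phi_tail_def True)
  next
    case False
    have "(u + Z)\<^sup>2 - (X p)\<^sup>2 dvd (\<Prod>t=j+1..l. (u + Z)\<^sup>2 - (X t)\<^sup>2)"
      using that False pq by (intro dvd_prodI) auto
    moreover have "(u + Z)\<^sup>2 - (X p)\<^sup>2 = ?a * (- (u + Z + X p))"
      by (simp add: algebra_simps power2_eq_square)
    ultimately have "?a dvd (\<Prod>t=j+1..l. (u + Z)\<^sup>2 - (X t)\<^sup>2)" by (metis dvd_mult_left)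
    then show ?thesis by (simp add: phi_tail_def)
  qed
  moreover have "phi_tail l j (- u) = 0" if "j \<le> p"
  proof (cases "j = q")
    case True
    with that pq u have "u = - X j" by auto
    then show ?thesis by (simp add: phi_tail_def)
  next
    case False
    have "(u)\<^sup>2 = (X q)\<^sup>2" using u by auto
    then have "(\<Prod>t=j+1..l. (- u)\<^sup>2 - (X t)\<^sup>2) = 0"
      using that False pq by (intro prod_zero bexI[of _ q]) auto
    then show ?thesis by (simp add: phi_tail_def)
  qed
  ultimately have "?a dvd phi_poly l j (u + Z) - phi_poly l j u"
    unfolding phi_poly_difference[OF j] by (cases "p < j") (auto intro: dvd_mult dvd_mult2)
  from dvd_add[OF phi_poly_cong[OF j, of "X p" "u + Z"] this] show ?thesis
    using True by (simp add: algebra_simps)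
next
  case False
  then show ?thesis using phi_poly_cong[OF j, of "X p" u] by simp
qed

section \<open>The linear forms of the arrangement\<close>

text \<open>The positive roots are indexed by all pairs: \<open>(a, a)\<close> stands for \<open>2x\<^sub>a\<close>, and a pair \<open>a < b\<close>
  and its transpose stand for \<open>x\<^sub>a + x\<^sub>b\<close> and \<open>x\<^sub>a - x\<^sub>b\<close>. With a Boolean for the translation by
  \<open>z\<close>, this makes the number of hyperplanes other than \<open>z = 0\<close> visibly \<open>2l\<^sup>2\<close>. The
  root is a linear function of the values \<open>v\<close> of the indeterminates, so that it can also be applied
  to the coefficients of a derivation.\<close>

definition pos_root :: "nat \<Rightarrow> nat \<Rightarrow> (nat \<Rightarrow> mpoly) \<Rightarrow> mpoly" where
  "pos_root a b v = (if a \<le> b then v a + v b else v b - v a)"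

definition form :: "bool \<Rightarrow> nat \<Rightarrow> nat \<Rightarrow> mpoly" where
  "form d a b = pos_root a b X - of_bool d * Z"

lemma subst_form: "subst v (form d a b) = pos_root a b v - of_bool d * v 0"
  by (simp add: form_def pos_root_def)

lemma form_in_S: "a \<le> l \<Longrightarrow> b \<le> l \<Longrightarrow> form d a b \<in> S l"
  by (cases d) (auto simp: form_def pos_root_def intro!: S_closed)

lemma pos_roots_C_eq: "pos_roots_C l = {pos_root a b X | a b. a \<in> {1..l} \<and> b \<in> {1..l}}"
proof
  show "pos_roots_C l \<subseteq> {pos_root a b X | a b. a \<in> {1..l} \<and> b \<in> {1..l}}"
    unfolding pos_roots_C_def
  proof (intro Un_least subsetI)
    fix \<alpha> assume "\<alpha> \<in> {2 * X i | i. 1 \<le> i \<and> i \<le> l}"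
    then obtain i where i: "\<alpha> = 2 * X i" "i \<in> {1..l}" by auto
    then have "\<alpha> = pos_root i i X" by (simp add: pos_root_def)
    with i show "\<alpha> \<in> {pos_root a b X | a b. a \<in> {1..l} \<and> b \<in> {1..l}}" by blast
  next
    fix \<alpha> assume "\<alpha> \<in> {X p + X q | p q. 1 \<le> p \<and> p < q \<and> q \<le> l}"
    then obtain p q where pq: "\<alpha> = X p + X q" "1 \<le> p" "p < q" "q \<le> l" by blast
    then have "\<alpha> = pos_root p q X" "p \<in> {1..l}" "q \<in> {1..l}" by (auto simp: pos_root_def)
    then show "\<alpha> \<in> {pos_root a b X | a b. a \<in> {1..l} \<and> b \<in> {1..l}}" by blast
  next
    fix \<alpha> assume "\<alpha> \<in> {X p - X q | p q. 1 \<le> p \<and> p < q \<and> q \<le> l}"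
    then obtain p q where pq: "\<alpha> = X p - X q" "1 \<le> p" "p < q" "q \<le> l" by blast
    then have "\<alpha> = pos_root q p X" "q \<in> {1..l}" "p \<in> {1..l}" by (auto simp: pos_root_def)
    then show "\<alpha> \<in> {pos_root a b X | a b. a \<in> {1..l} \<and> b \<in> {1..l}}" by blast
  qed
  show "{pos_root a b X | a b. a \<in> {1..l} \<and> b \<in> {1..l}} \<subseteq> pos_roots_C l"
  proof
    fix \<alpha> assume "\<alpha> \<in> {pos_root a b X | a b. a \<in> {1..l} \<and> b \<in> {1..l}}"
    then obtain a b where ab: "\<alpha> = pos_root a b X" "a \<in> {1..l}" "b \<in> {1..l}" by blast
    consider "a = b" | "a < b" | "b < a" by linarith
    then show "\<alpha> \<in> pos_roots_C l"
    proof cases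
      case 1
      then have "\<alpha> = 2 * X a" using ab(1) by (simp add: pos_root_def)
      then show ?thesis using ab(2) unfolding pos_roots_C_def by fastforce
    next
      case 2
      then have "\<alpha> = X a + X b" using ab(1) by (simp add: pos_root_def)
      then show ?thesis using 2 ab(2,3) unfolding pos_roots_C_def by fastforce
    next
      case 3
      then have "\<alpha> = X b - X a" using ab(1) by (simp add: pos_root_def)
      then show ?thesis using 3 ab(2,3) unfolding pos_roots_C_def by fastforce
    qed
  qed
qed

text \<open>Divisibility by a form is the vanishing of a substitution that solves the form for \<open>x\<^sub>a\<close>;
  hence the form is prime.\<close>

lemma form_dvd_iff:
  assumes "1 \<le> a" "1 \<le> b"
  obtains g where "\<And>f. form d a b dvd f \<longleftrightarrow> subst g f = 0"
proof -
  define w where "w = (if a = b then cst (1/2) * (of_bool d * Z)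
    else if a < b then of_bool d * Z - X b else X b - of_bool d * Z)"
  define g where "g = X(a := w)"
  have half: "cst (1/2) * 2 = 1"
    using cst_mult[of "1/2" 2] by simp
  have half': "cst (1/2) + cst (1/2) = 1"
    by (simp flip: cst_add)
  have zero: "subst g (form d a b) = 0"
    unfolding subst_form g_def w_def pos_root_def using assms half'
    by (auto simp: distrib_right[symmetric] mult_2[symmetric] mult.assoc[symmetric])
  have "X a - w = form d a b * (if a = b then cst (1/2) else if a < b then 1 else - 1)"
    unfolding w_def form_def pos_root_def using half
    by (auto simp: algebra_simps mult_2[symmetric])
  then have dvd: "form d a b dvd X i - g i" for i
    by (cases "i = a") (simp_all add: g_def)
  show ?thesis
  proof (rule that[of g])
    fix f
    show "form d a b dvd f \<longleftrightarrow> subst g f = 0"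
      using dvd_diff_subst[of "form d a b" g f] dvd zero by (auto elim!: dvdE)
  qed
qed

lemma form_prime:
  assumes "1 \<le> a" "1 \<le> b"
  shows "prime_elem (form d a b)"
proof -
  obtain g where g: "\<And>f. form d a b dvd f \<longleftrightarrow> subst g f = 0"
    using form_dvd_iff[OF assms] by blast
  have "subst (\<lambda>i. if i = b then 1 else 0) (form d a b) \<noteq> 0"
    using assms by (auto simp: subst_form pos_root_def)
  then show ?thesis
    unfolding prime_elem_def g by auto
qed

text \<open>Distinct forms are not associate: otherwise every point on the hyperplane of the first would
  lie on that of the second. The proof chooses points with coordinates \<open>0\<close>, \<open>1\<close>, \<open>-1\<close>, \<open>2\<close>.\<close>

lemma form_dvd_form:
  assumes "1 \<le> a" "1 \<le> b" "1 \<le> a'" "1 \<le> b'" and dvd: "form d a b dvd form d' a' b'"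
  shows "d = d' \<and> a = a' \<and> b = b'"
proof -
  have test: "pos_root a' b' v = of_bool d' * v 0" if "pos_root a b v = of_bool d * v 0" for v
  proof -
    have "subst v (form d a b) dvd subst v (form d' a' b')" using dvd by (auto elim!: dvdE)
    with that show ?thesis by (simp add: subst_form)
  qed
  have "k \<in> {a, b}" if "k \<in> {a', b'}" for k
  proof (rule ccontr)
    let ?v = "\<lambda>i. if i = k then 1 else 0"
    assume "k \<notin> {a, b}"
    then have "pos_root a b ?v = of_bool d * ?v 0"
      using that assms by (auto simp: pos_root_def)
    from test[OF this] show False
      using that assms by (auto simp: pos_root_def split: if_splits)
  qed
  then have sub: "a' \<in> {a, b}" "b' \<in> {a, b}" by auto
  show ?thesis
  proof (cases "a = b")
    case True
    then show ?thesis
      using sub test[of "(\<lambda>_. 0)(0 := 2, a := of_bool d)"] assms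
      by (cases d; cases d') (auto simp: pos_root_def)
  next
    case False
    let ?v = "(\<lambda>_. 0)(a := 1, b := if a < b then - 1 else 1)"
    have "pos_root a b ?v = of_bool d * ?v 0"
      using False assms by (auto simp: pos_root_def)
    from test[OF this] have "pos_root a' b' ?v = 0" using assms by auto
    then have "a' = a \<and> b' = b"
      using sub False by (auto simp: pos_root_def split: if_splits)
    moreover
    let ?w = "(\<lambda>_. 0)(0 := 1, b := of_bool d)"
    have "pos_root a b ?w = of_bool d * ?w 0"
      using False assms by (auto simp: pos_root_def)
    from test[OF this] have "pos_root a' b' ?w = of_bool d'" using assms by auto
    then have "d = d'"
      using False assms calculation by (cases d; cases d') (auto simp: pos_root_def split: if_splits)
    ultimately show ?thesis by simp
  qed
qed

lemma prod_prime_elems_dvd: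
  assumes "finite I" and "\<And>i. i \<in> I \<Longrightarrow> prime_elem (p i)"
    and "\<And>i j. i \<in> I \<Longrightarrow> j \<in> I \<Longrightarrow> p i dvd p j \<Longrightarrow> i = j"
    and "\<And>i. i \<in> I \<Longrightarrow> p i dvd f"
  shows "prod p I dvd (f :: 'a::comm_semiring_1)"
  using assms
proof (induction I rule: finite_induct)
  case (insert i I)
  have not_dvd: "\<not> p i dvd prod p J" if "J \<subseteq> I" for J
    using finite_subset[OF that insert.hyps(1)] that
  proof (induction J rule: finite_induct)
    case empty
    show ?case using insert.prems(1)[of i] by (simp add: prime_elem_def)
  next
    case (insert j J)
    have "prime_elem (p i)" "\<not> p i dvd p j"
      using insert.prems \<open>i \<notin> I\<close> \<open>\<And>i j. i \<in> insert _ I \<Longrightarrow> _ \<Longrightarrow> _ \<Longrightarrow> i = j\<close>[of i j]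
        \<open>\<And>k. k \<in> insert i I \<Longrightarrow> prime_elem (p k)\<close> by auto
    with insert show ?case by (auto simp: prime_elem_dvd_mult_iff)
  qed
  from insert have "prod p I dvd f" by blast
  then obtain q where q: "f = prod p I * q" ..
  moreover have "p i dvd f" "prime_elem (p i)" using insert.prems by auto
  ultimately have "p i dvd q" using not_dvd[of I] by (auto simp: prime_elem_dvd_mult_iff)
  with q insert.hyps show ?case by (auto elim!: dvdE simp: mult_ac)
qed simp

text \<open>The defining polynomial of the arrangement without the factor \<open>z\<close>, up to a constant.\<close>

definition forms_prod :: "nat \<Rightarrow> mpoly" where
  "forms_prod l = (\<Prod>(d, a, b)\<in>UNIV \<times> {1..l} \<times> {1..l}. form d a b)"

lemma forms_prod_dvd:
  assumes "\<And>d a b. a \<in> {1..l} \<Longrightarrow> b \<in> {1..l} \<Longrightarrow> form d a b dvd f"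
  shows "forms_prod l dvd f"
  unfolding forms_prod_def
proof (rule prod_prime_elems_dvd)
  fix i j :: "bool \<times> nat \<times> nat"
  assume ij: "i \<in> UNIV \<times> {1..l} \<times> {1..l}" "j \<in> UNIV \<times> {1..l} \<times> {1..l}"
    and dvd: "(case i of (d, a, b) \<Rightarrow> form d a b) dvd (case j of (d, a, b) \<Rightarrow> form d a b)"
  obtain d a b d' a' b' where "i = (d, a, b)" "j = (d', a', b')"
    using prod_cases3 by metis
  with ij dvd show "i = j"
    using form_dvd_form[of a b a' b' d d'] by auto
qed (use assms in \<open>auto intro: form_prime\<close>)

section \<open>Linear independence\<close>

lemma indet_neq_zero [simp]: "X i \<noteq> 0"
proof
  assume "X i = 0"
  then have "subst (\<lambda>_. 1) (X i) = subst (\<lambda>_. 1) 0" by simp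
  then show False by simp
qed

lemma indet_eq_iff [simp]: "X i = X j \<longleftrightarrow> i = j"
proof
  assume "X i = X j"
  then have "subst (\<lambda>k. if k = i then 1 else 0) (X i) = subst (\<lambda>k. if k = i then 1 else 0) (X j)"
    by simp
  then show "i = j" by (simp split: if_splits)
qed simp

lemma indet_neq_minus [simp]: "X i \<noteq> - X j"
proof
  assume "X i = - X j"
  then have "subst (\<lambda>_. 1) (X i) = subst (\<lambda>_. 1) (- X j)" by simp
  then show False by simp
qed

lemma polynomial_zero_if_roots:
  assumes "degree p \<le> 2 * l" "poly p 0 = 0"
    and "\<And>i. i \<in> {1..l} \<Longrightarrow> poly p (X i) = 0" "\<And>i. i \<in> {1..l} \<Longrightarrow> poly p (- X i) = 0"
  shows "p = 0"
proof (rule ccontr)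
  assume "p \<noteq> 0"
  let ?R = "insert 0 (X ` {1..l} \<union> (\<lambda>i. - X i) ` {1..l})"
  have "card ?R = Suc (card (X ` {1..l} \<union> (\<lambda>i. - X i) ` {1..l}))"
    by (subst card_insert_disjoint) (auto simp: eq_commute[of 0])
  also have "card (X ` {1..l} \<union> (\<lambda>i. - X i) ` {1..l}) = l + l"
    by (subst card_Un_disjoint) (auto simp: card_image inj_on_def)
  finally have "2 * l < card ?R" by simp
  also have "card ?R \<le> card {x. poly p x = 0}"
    using assms \<open>p \<noteq> 0\<close> by (intro card_mono poly_roots_finite) auto
  also have "\<dots> \<le> degree p" using \<open>p \<noteq> 0\<close> by (rule card_poly_roots_bound)
  finally show False using assms(1) by simp
qed

text \<open>At \<open>u = - x\<^sub>m\<close> the differences form a triangular system. The nonzero values are recognized at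
  the point \<open>z = 1\<close>, \<open>x\<^sub>i = 0\<close>.\<close>

lemma phi_difference_triangular:
  assumes "1 \<le> j" "j \<le> l"
  shows "m < j \<Longrightarrow> 1 \<le> m \<Longrightarrow> phi_poly l j (- X m + Z) - phi_poly l j (- X m) = 0"
    and "phi_poly l j (- X j + Z) - phi_poly l j (- X j) \<noteq> 0"
proof -
  assume "m < j" "1 \<le> m"
  then have "(\<Prod>t=1..<j. (X t + - X m) * (X t - - X m - Z)) = 0"
    by (intro prod_zero bexI[of _ m]) auto
  then show "phi_poly l j (- X m + Z) - phi_poly l j (- X m) = 0"
    unfolding phi_poly_difference[OF assms] by simp
next
  have nonzero: "f \<noteq> 0" if "subst (\<lambda>i. if i = 0 then 1 else 0) f \<noteq> 0" for f
    using that by auto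
  have "(\<Prod>t=1..<j. (X t + - X j) * (X t - - X j - Z)) \<noteq> 0"
  proof -
    have "X t + X j \<noteq> Z" if "1 \<le> t" for t
      using that assms nonzero[of "X t + X j - Z"] by auto
    then show ?thesis by auto
  qed
  moreover have "phi_tail l j (- X j + Z) \<noteq> 0"
  proof -
    have "Z \<noteq> 2 * X j" using assms nonzero[of "Z - 2 * X j"] by auto
    moreover have "(Z - X j)\<^sup>2 \<noteq> (X t)\<^sup>2" if "1 \<le> t" for t
      using that assms nonzero[of "(Z - X j)\<^sup>2 - (X t)\<^sup>2"] by auto
    ultimately show ?thesis unfolding phi_tail_def by auto
  qed
  moreover have "phi_tail l j (- (- X j)) = 0"
    by (simp add: phi_tail_def)
  ultimately show "phi_poly l j (- X j + Z) - phi_poly l j (- X j) \<noteq> 0"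
    unfolding phi_poly_difference[OF assms] by simp
qed

text \<open>A relation yields a polynomial in \<open>u\<close> of degree at most \<open>2l\<close> with the \<open>2l + 1\<close> roots \<open>0\<close> and
  \<open>\<plusminus> x\<^sub>i\<close>. It vanishes, hence so does its difference, whose coefficients are eliminated one by one at
  \<open>u = - x\<^sub>1, - x\<^sub>2, \<dots>\<close>\<close>

lemma phi_independent:
  assumes rel: "\<And>i. i \<in> {1..l} \<Longrightarrow> (\<Sum>j=1..l. h j * phi_poly l j (X i)) = 0"
    and "m \<in> {1..l}"
  shows "h m = 0"
proof -
  have "\<exists>p. degree p \<le> 2 * l \<and> (\<forall>u. (\<Sum>j=1..l. h j * phi_poly l j u) = poly p u)"
    by (intro polynomial_function_sum polynomial_function_scale phi_poly_polynomial) auto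
  then obtain p where p: "degree p \<le> 2 * l"
    "\<And>u. (\<Sum>j=1..l. h j * phi_poly l j u) = poly p u" by blast
  have "poly p (- X i) = 0" if "i \<in> {1..l}" for i
  proof -
    have "poly p (- X i) = (\<Sum>j=1..l. - (h j * phi_poly l j (X i)))"
      unfolding p(2)[symmetric] by (intro sum.cong) (auto simp: phi_poly_minus)
    then show ?thesis using rel[OF that] by (simp add: sum_negf)
  qed
  moreover have "poly p 0 = 0"
    unfolding p(2)[symmetric] by (intro sum.neutral) (auto simp: phi_poly_0)
  ultimately have "p = 0"
    using p rel by (intro polynomial_zero_if_roots[of p l]) auto
  have diff: "(\<Sum>j=1..l. h j * (phi_poly l j (u + Z) - phi_poly l j u)) = 0" for u
    using p(2)[of "u + Z"] p(2)[of u] \<open>p = 0\<close>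
    by (simp add: right_diff_distrib sum_subtractf)
  show ?thesis using \<open>m \<in> {1..l}\<close>
  proof (induction m rule: less_induct)
    case (less m)
    have "h j * (phi_poly l j (- X m + Z) - phi_poly l j (- X m)) = 0"
      if "j \<in> {1..l} - {m}" for j
    proof (cases "j < m")
      case True
      then show ?thesis using less.IH[of j] that by simp
    next
      case False
      then have "phi_poly l j (- X m + Z) - phi_poly l j (- X m) = 0"
        using that less.prems by (intro phi_difference_triangular(1)) auto
      then show ?thesis by simp
    qed
    then have "(\<Sum>j\<in>{1..l} - {m}. h j * (phi_poly l j (- X m + Z) - phi_poly l j (- X m))) = 0"
      by (intro sum.neutral ballI)
    moreover have "(\<Sum>j=1..l. h j * (phi_poly l j (- X m + Z) - phi_poly l j (- X m)))
        = h m * (phi_poly l m (- X m + Z) - phi_poly l m (- X m))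
          + (\<Sum>j\<in>{1..l} - {m}. h j * (phi_poly l j (- X m + Z) - phi_poly l j (- X m)))"
      using less.prems by (intro sum.remove) auto
    ultimately have "h m * (phi_poly l m (- X m + Z) - phi_poly l m (- X m)) = 0"
      unfolding diff by simp
    then show ?case
      using phi_difference_triangular(2)[of m l] less.prems by auto
  qed
qed

section \<open>Homogeneity\<close>

text \<open>An element of \<open>S l\<close> is homogeneous of degree \<open>n\<close> if multiplying all indeterminates by the one
  of index \<open>Suc l\<close>, which does not occur in it, multiplies the element by the \<open>n\<close>-th power of that
  indeterminate.\<close>

abbreviation scale :: "nat \<Rightarrow> mpoly \<Rightarrow> mpoly" where
  "scale l \<equiv> subst (\<lambda>i. X (Suc l) * X i)"

lemma scale_B_bar:
  assumes "scale l u = X (Suc l) * u"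
  shows "scale l (B_bar r s u) = X (Suc l) ^ (r + 2 * s) * B_bar r s u"
  unfolding B_bar_def subst_hom sum_distrib_left
proof (intro sum.cong refl)
  fix k assume "k \<in> {..r + 2 * s}"
  then have T: "X (Suc l) ^ (r + 2 * s) = X (Suc l) ^ k * X (Suc l) ^ (r + 2 * s - k)"
    by (simp flip: power_add)
  show "subst (\<lambda>i. X (Suc l) * X i) (cst (coeff (B_C r s) k))
      * scale l u ^ k * scale l Z ^ (r + 2 * s - k)
    = X (Suc l) ^ (r + 2 * s) * (cst (coeff (B_C r s) k) * u ^ k * Z ^ (r + 2 * s - k))"
    unfolding assms T subst_cst subst_indet power_mult_distrib by (simp only: mult_ac)
qed

lemma scale_esym:
  assumes "\<And>i. i \<in> A \<Longrightarrow> scale l (f i) = X (Suc l) ^ e * f i"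
  shows "scale l (esym k A f) = X (Suc l) ^ (e * k) * esym k A f"
  unfolding esym_def subst_hom sum_distrib_left
proof (intro sum.cong refl)
  fix T assume T: "T \<in> {T. T \<subseteq> A \<and> card T = k}"
  then have "(\<Prod>i\<in>T. scale l (f i)) = (\<Prod>i\<in>T. X (Suc l) ^ e * f i)"
    using assms by (intro prod.cong) auto
  then show "(\<Prod>i\<in>T. scale l (f i)) = X (Suc l) ^ (e * k) * prod f T"
    using T by (simp add: prod.distrib power_mult)
qed

lemma scale_phi_poly:
  assumes j: "1 \<le> j" "j \<le> l" and u: "scale l u = X (Suc l) * u"
  shows "scale l (phi_poly l j u) = X (Suc l) ^ (2 * l) * phi_poly l j u"
  unfolding phi_poly_def case_prod_unfold subst_hom sum_distrib_left
proof (intro sum.cong refl, goal_cases)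
  case (1 N k2 k3)
  let ?T = "X (Suc l)"
  let ?r = "2 * l + 2 - 2 * j - k2 - 2 * k3" and ?s = "j - 1 - card (fst N) - card (snd N)"
  from 1 have N: "fst N \<subseteq> {1..<j}" "snd N \<subseteq> {1..<j}" "fst N \<inter> snd N = {}"
    and k: "k2 \<le> 1" "k3 \<le> l - j" by auto
  have "finite (fst N)" "finite (snd N)" using N finite_subset by blast+
  then have "card (fst N) + card (snd N) = card (fst N \<union> snd N)"
    using N(3) by (simp add: card_Un_disjoint)
  also have "\<dots> \<le> card {1..<j}" using N by (intro card_mono) auto
  finally have "card (fst N) + card (snd N) \<le> j - 1" by simp
  then have degree: "2 * l = 2 * card (fst N) + 2 * card (snd N) + k2 + 2 * k3 + (?r + 2 * ?s)"
    using j k by simp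
  have T: "?T ^ (2 * l) = ?T ^ (2 * card (fst N)) * ?T ^ (2 * card (snd N)) * ?T ^ k2
      * ?T ^ (2 * k3) * ?T ^ (?r + 2 * ?s)"
    using arg_cong[OF degree, of "\<lambda>n. ?T ^ n"] by (simp only: power_add)
  have "(\<Prod>t\<in>fst N. (?T * X t)\<^sup>2) = ?T ^ (2 * card (fst N)) * (\<Prod>t\<in>fst N. (X t)\<^sup>2)"
    by (simp add: power_mult_distrib prod.distrib power_mult)
  moreover have "(\<Prod>t\<in>snd N. - (?T * X t * (?T * Z)))
      = ?T ^ (2 * card (snd N)) * (\<Prod>t\<in>snd N. - (X t * Z))"
  proof -
    have "(\<Prod>t\<in>snd N. - (?T * X t * (?T * Z))) = (\<Prod>t\<in>snd N. ?T\<^sup>2 * - (X t * Z))"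
      by (intro prod.cong refl) (simp add: power2_eq_square algebra_simps)
    then show ?thesis by (simp only: prod.distrib prod_constant power_mult)
  qed
  moreover have "scale l (esym k2 {j} X) = ?T ^ k2 * esym k2 {j} X"
    using scale_esym[of "{j}" l X 1 k2] by simp
  moreover have "scale l (esym k3 {j+1..l} (\<lambda>t. (X t)\<^sup>2))
      = ?T ^ (2 * k3) * esym k3 {j+1..l} (\<lambda>t. (X t)\<^sup>2)"
    by (intro scale_esym) (simp add: power_mult_distrib)
  ultimately show ?case
    unfolding T scale_B_bar[OF u] subst_indet subst_1 by (simp only: mult_ac)
qed

lemma scale_forms_prod: "scale l (forms_prod l) = X (Suc l) ^ (2 * l * l) * forms_prod l"
proof -
  have "scale l (form d a b) = X (Suc l) * form d a b" for d a b
    by (cases d) (auto simp: form_def pos_root_def algebra_simps)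
  then have "scale l (forms_prod l)
      = (\<Prod>(d, a, b)\<in>UNIV \<times> {1..l} \<times> {1..l}. X (Suc l) * form d a b)"
    by (simp only: forms_prod_def case_prod_unfold subst_hom)
  also have "\<dots> = X (Suc l) ^ card ((UNIV :: bool set) \<times> {1..l} \<times> {1..l}) * forms_prod l"
    by (simp only: forms_prod_def case_prod_unfold prod.distrib prod_constant)
  also have "card ((UNIV :: bool set) \<times> {1..l} \<times> {1..l}) = 2 * l * l"
    by (simp only: card_cartesian_product card_UNIV_bool card_atLeastAtMost) simp
  finally show ?thesis .
qed

text \<open>The quotient of two homogeneous polynomials of the same degree is invariant under scaling;
  sending the scaling factor to \<open>0\<close> shows that it is constant.\<close>

lemma homogeneous_quotient_const:
  assumes "scale l f = X (Suc l) ^ n * f" "scale l g = X (Suc l) ^ n * g"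
    and "f \<in> S l" "g \<in> S l" "g \<noteq> 0" "g dvd f"
  obtains c where "f = cst c * g"
proof -
  have "dvd_in (S l) g f" using assms by (simp add: dvd_in_S_iff)
  then obtain q where q: "q \<in> S l" "f = g * q" by (auto simp: dvd_in_def)
  have "X (Suc l) ^ n * g * scale l q = X (Suc l) ^ n * g * q"
    using assms(1,2) q(2) by (simp add: mult_ac)
  then have "scale l q = q" using \<open>g \<noteq> 0\<close> by simp
  then have "subst (X(Suc l := 0)) (scale l q) = subst (X(Suc l := 0)) q" by simp
  moreover have "subst (X(Suc l := 0)) q = q" using q(1) by (rule subst_S_ident) auto
  moreover have "subst (X(Suc l := 0)) (scale l q) = subst (\<lambda>_. 0) q"
    by (simp add: subst_compose)
  ultimately obtain c where "q = cst c" using subst_const[of q] by metis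
  then show ?thesis using q(2) that[of c] by (simp add: mult.commute)
qed

section \<open>Determinants and spanning\<close>

text \<open>The divisibility conditions on the values \<open>v i\<close> at \<open>x\<^sub>i\<close> of a derivation that maps \<open>z\<close> to \<open>0\<close>
  and belongs to the derivation module of the arrangement.\<close>

definition admissible :: "nat \<Rightarrow> (nat \<Rightarrow> mpoly) \<Rightarrow> bool" where
  "admissible l v \<longleftrightarrow> (\<forall>d. \<forall>a\<in>{1..l}. \<forall>b\<in>{1..l}. form d a b dvd pos_root a b v)"

lemma pos_root_cong: "v a = v' a \<Longrightarrow> v b = v' b \<Longrightarrow> pos_root a b v = pos_root a b v'"
  by (simp add: pos_root_def)

lemma admissible_cong: "(\<And>i. i \<in> {1..l} \<Longrightarrow> v i = v' i) \<Longrightarrow> admissible l v \<longleftrightarrow> admissible l v'"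
  unfolding admissible_def by (metis pos_root_cong)

lemma pos_root_scale: "pos_root a b (\<lambda>i. c * v i) = c * pos_root a b v"
  by (simp add: pos_root_def distrib_left right_diff_distrib)

lemma pos_root_diff: "pos_root a b (\<lambda>i. v i - w i) = pos_root a b v - pos_root a b w"
  by (simp add: pos_root_def)

lemma pos_root_sum: "pos_root a b (\<lambda>i. \<Sum>k\<in>K. v k i) = (\<Sum>k\<in>K. pos_root a b (v k))"
  by (simp add: pos_root_def sum.distrib sum_subtractf)

lemma admissible_scale: "admissible l v \<Longrightarrow> admissible l (\<lambda>i. c * v i)"
  by (simp add: admissible_def pos_root_scale)

lemma admissible_phi:
  assumes "1 \<le> j" "j \<le> l"
  shows "admissible l (\<lambda>i. phi_poly l j (X i))"
  unfolding admissible_def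
proof (intro allI ballI)
  fix d a b assume ab: "a \<in> {1..l}" "b \<in> {1..l}"
  show "form d a b dvd pos_root a b (\<lambda>i. phi_poly l j (X i))"
  proof (cases "a \<le> b")
    case True
    then show ?thesis
      using phi_poly_hyperplane[OF assms, of a b "- X b" d] ab
      by (simp add: form_def pos_root_def phi_poly_minus[OF assms])
  next
    case False
    then show ?thesis
      using phi_poly_hyperplane[OF assms, of b a "X a" d] ab
      by (simp add: form_def pos_root_def)
  qed
qed

text \<open>Modulo a form, two rows of the matrix agree up to sign, or one row vanishes; multiplying by
  the adjugate turns this into divisibility of the determinant.\<close>

lemma form_dvd_det:
  assumes N: "N \<in> carrier_mat l l" and cols: "\<And>k. k < l \<Longrightarrow> admissible l (\<lambda>i. N $$ (i - 1, k))"
    and ab: "a \<in> {1..l}" "b \<in> {1..l}"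
  shows "form d a b dvd det N"
proof -
  let ?A = "adj_mat N"
  have A: "?A \<in> carrier_mat l l" "N * ?A = det N \<cdot>\<^sub>m 1\<^sub>m l" using adj_mat[OF N] by auto
  have entry: "(\<Sum>m<l. ?A $$ (m, b - 1) * N $$ (i - 1, m)) = (if i = b then det N else 0)"
    if "i \<in> {1..l}" for i
  proof -
    have "(N * ?A) $$ (i - 1, b - 1) = (\<Sum>m<l. ?A $$ (m, b - 1) * N $$ (i - 1, m))"
    proof -
      have "i - 1 < l" "b - 1 < l" using that ab by auto
      then show ?thesis
        using N A(1) by (simp add: scalar_prod_def lessThan_atLeast0 mult.commute)
    qed
    moreover have "(N * ?A) $$ (i - 1, b - 1) = (if i = b then det N else 0)"
      using that ab by (auto simp: A(2))
    ultimately show ?thesis by simp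
  qed
  have "pos_root a b (\<lambda>i. if i = b then det N else 0)
      = pos_root a b (\<lambda>i. \<Sum>m<l. ?A $$ (m, b - 1) * N $$ (i - 1, m))"
    using ab by (intro pos_root_cong) (simp_all only: entry)
  also have "\<dots> = (\<Sum>m<l. ?A $$ (m, b - 1) * pos_root a b (\<lambda>i. N $$ (i - 1, m)))"
    by (simp only: pos_root_sum pos_root_scale)
  also have "form d a b dvd \<dots>"
    using cols ab by (intro dvd_sum dvd_mult) (auto simp: admissible_def)
  \<comment> \<open>for \<open>a = b\<close> the left-hand side is twice the determinant\<close>
  finally have "form d a b dvd cst (if a = b then 1/2 else 1)
      * pos_root a b (\<lambda>i. if i = b then det N else 0)" by (rule dvd_mult)
  also have "cst (if a = b then 1/2 else 1) * pos_root a b (\<lambda>i. if i = b then det N else 0) = det N"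
    using cst_mult[of "1/2" 2] by (auto simp: pos_root_def mult.assoc[symmetric] mult_2[symmetric])
  finally show ?thesis .
qed

text \<open>The coefficient matrix of \<open>\<phi>\<^sub>1, \<dots>, \<phi>\<^sub>l\<close>. Matrix indices start at \<open>0\<close>, those of the indeterminates
  and derivations at \<open>1\<close>.\<close>

definition phi_mat :: "nat \<Rightarrow> mpoly mat" where
  "phi_mat l = mat l l (\<lambda>(i, k). (- 1) ^ Suc k * phi_poly l (Suc k) (X (Suc i)))"

lemma phi_mat_carrier [simp]: "phi_mat l \<in> carrier_mat l l"
  by (simp add: phi_mat_def)

lemma admissible_phi_mat:
  assumes "k < l"
  shows "admissible l (\<lambda>i. phi_mat l $$ (i - 1, k))"
proof -
  have "admissible l (\<lambda>i. (- 1) ^ Suc k * phi_poly l (Suc k) (X i))"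
    using assms by (intro admissible_scale admissible_phi) auto
  then show ?thesis
    by (rule admissible_cong[THEN iffD1, rotated]) (use assms in \<open>auto simp: phi_mat_def\<close>)
qed

lemma phi_mat_mult_vec:
  assumes "v \<in> carrier_vec l" "i \<in> {1..l}"
  shows "(phi_mat l *\<^sub>v v) $ (i - 1)
    = (\<Sum>j=1..l. v $ (j - 1) * ((- 1) ^ j * phi_poly l j (X i)))"
proof -
  have "(phi_mat l *\<^sub>v v) $ (i - 1)
      = (\<Sum>k<l. v $ k * ((- 1) ^ Suc k * phi_poly l (Suc k) (X i)))"
  proof -
    have "i - 1 < l" "Suc (i - 1) = i" using assms(2) by auto
    then show ?thesis
      using assms(1) by (simp add: phi_mat_def scalar_prod_def lessThan_atLeast0 mult_ac)
  qed
  also have "\<dots> = (\<Sum>j=1..l. v $ (j - 1) * ((- 1) ^ j * phi_poly l j (X i)))"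
    by (rule sum.reindex_bij_witness[of _ "\<lambda>j. j - 1" Suc]) auto
  finally show ?thesis .
qed

lemma det_phi_mat_nonzero: "det (phi_mat l) \<noteq> 0"
proof
  assume "det (phi_mat l) = 0"
  then obtain v where v: "v \<in> carrier_vec l" "v \<noteq> 0\<^sub>v l" "phi_mat l *\<^sub>v v = 0\<^sub>v l"
    using det_0_iff_vec_prod_zero[OF phi_mat_carrier] by blast
  have "(\<Sum>j=1..l. (v $ (j - 1) * (- 1) ^ j) * phi_poly l j (X i)) = 0" if "i \<in> {1..l}" for i
    using phi_mat_mult_vec[OF v(1) that] v(3) that by (auto simp: mult.assoc)
  then have zero: "v $ (j - 1) * (- 1) ^ j = 0" if "j \<in> {1..l}" for j
    using phi_independent[of l "\<lambda>j. v $ (j - 1) * (- 1) ^ j" j] that by blast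
  have "v $ k = 0" if "k < l" for k
    using zero[of "Suc k"] that by simp
  with v(1) have "v = 0\<^sub>v l" by (intro eq_vecI) auto
  with v(2) show False by contradiction
qed

text \<open>Both sides are homogeneous of degree \<open>2l\<^sup>2\<close>.\<close>

lemma det_phi_mat: obtains c where "c \<noteq> 0" "det (phi_mat l) = cst c * forms_prod l"
proof -
  have dvd: "forms_prod l dvd det (phi_mat l)"
    by (intro forms_prod_dvd form_dvd_det[OF phi_mat_carrier admissible_phi_mat])
  have "of_int (sign p) \<in> S l" for p :: "nat \<Rightarrow> nat"
    by (cases p rule: sign_cases) (simp_all add: S_1 S_uminus)
  moreover have "phi_mat l $$ (i, p i) \<in> S l" if "p permutes {0..<l}" "i \<in> {0..<l}" for p i
    using permutes_in_image[OF that(1), of i] that(2)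
    by (auto simp: phi_mat_def intro!: S_mult S_uminus S_power S_1 phi_poly_in_S S_indet)
  ultimately have S: "det (phi_mat l) \<in> S l"
    unfolding det_def'[OF phi_mat_carrier]
    by (intro S_sum S_mult S_prod) auto
  have "map_mat (scale l) (phi_mat l) = X (Suc l) ^ (2 * l) \<cdot>\<^sub>m phi_mat l"
    by (rule eq_matI) (auto simp: phi_mat_def scale_phi_poly)
  then have "scale l (det (phi_mat l)) = det (X (Suc l) ^ (2 * l) \<cdot>\<^sub>m phi_mat l)"
    by (simp flip: subst.hom_det)
  also have "\<dots> = X (Suc l) ^ (2 * l * l) * det (phi_mat l)"
    by (simp add: phi_mat_def power_mult)
  finally have hom: "scale l (det (phi_mat l)) = X (Suc l) ^ (2 * l * l) * det (phi_mat l)" .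
  have "forms_prod l \<in> S l"
    unfolding forms_prod_def by (intro S_prod) (auto intro: form_in_S)
  moreover have "forms_prod l \<noteq> 0" using dvd det_phi_mat_nonzero[of l] by auto
  ultimately obtain c where c: "det (phi_mat l) = cst c * forms_prod l"
    using homogeneous_quotient_const[OF hom scale_forms_prod S _ _ dvd] by blast
  moreover have "c \<noteq> 0" using c det_phi_mat_nonzero[of l] by auto
  ultimately show ?thesis using that by blast
qed

text \<open>By Cramer's rule the coefficients are quotients of determinants by the determinant of the
  coefficient matrix. The numerators are divisible by the product of the forms, because replacing a
  column by an admissible one keeps all columns admissible.\<close>

lemma admissible_spanned:
  assumes adm: "admissible l f" and f: "\<And>i. i \<in> {1..l} \<Longrightarrow> f i \<in> S l"
  obtains h where "\<And>j. h j \<in> S l"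
    "\<And>i. i \<in> {1..l} \<Longrightarrow> f i = (\<Sum>j=1..l. h j * ((- 1) ^ j * phi_poly l j (X i)))"
proof -
  let ?M = "phi_mat l" and ?Q = "forms_prod l"
  define b where "b = vec l (\<lambda>i. f (Suc i))"
  define x where "x = adj_mat ?M *\<^sub>v b"
  have b: "b \<in> carrier_vec l" by (simp add: b_def)
  have x: "x \<in> carrier_vec l"
    unfolding x_def using adj_mat(1)[OF phi_mat_carrier] b by (rule mult_mat_vec_carrier)
  have Mx: "?M *\<^sub>v x = det ?M \<cdot>\<^sub>v b"
  proof -
    have "?M *\<^sub>v x = (?M * adj_mat ?M) *\<^sub>v b"
      unfolding x_def
      using phi_mat_carrier adj_mat(1)[OF phi_mat_carrier] b by (rule assoc_mult_mat_vec[symmetric])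
    also have "\<dots> = det ?M \<cdot>\<^sub>v b"
      using b by (intro eq_vecI) (auto simp: adj_mat(2)[OF phi_mat_carrier])
    finally show ?thesis .
  qed
  have "?Q dvd x $ k" if k: "k < l" for k
  proof -
    let ?N = "replace_col ?M b k"
    have N: "?N \<in> carrier_mat l l" by (simp add: replace_col_def phi_mat_def)
    have "admissible l (\<lambda>i. ?N $$ (i - 1, m))" if m: "m < l" for m
    proof (cases "m = k")
      case True
      show ?thesis
        by (rule admissible_cong[THEN iffD1, OF _ adm])
           (use True m in \<open>auto simp: replace_col_def phi_mat_def b_def\<close>)
    next
      case False
      show ?thesis
        by (rule admissible_cong[THEN iffD1, OF _ admissible_phi_mat[OF m]])
           (use False m in \<open>auto simp: replace_col_def phi_mat_def\<close>)
    qed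
    then have "?Q dvd det ?N"
      by (intro forms_prod_dvd form_dvd_det[OF N]) auto
    moreover have "x $ k = det ?N"
    proof -
      have minor: "cofactor ?N i k = cofactor ?M i k" for i
      proof -
        have "mat_delete ?N i k = mat_delete ?M i k"
          by (rule eq_matI) (auto simp: mat_delete_def replace_col_def phi_mat_def)
        then show ?thesis by (simp add: cofactor_def)
      qed
      have "x $ k = (\<Sum>i<l. cofactor ?M i k * b $ i)"
        using k b unfolding x_def
        by (simp add: adj_mat_def phi_mat_def scalar_prod_def lessThan_atLeast0)
      also have "\<dots> = (\<Sum>i<l. ?N $$ (i, k) * cofactor ?N i k)"
        unfolding minor using k
        by (intro sum.cong refl) (simp add: replace_col_def phi_mat_def)
      finally show ?thesis by (simp only: laplace_expansion_column[OF N k])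
    qed
    ultimately show ?thesis by simp
  qed
  then have "\<forall>k. \<exists>g. k < l \<longrightarrow> x $ k = ?Q * g" by (auto elim!: dvdE)
  then obtain g where g: "\<And>k. k < l \<Longrightarrow> x $ k = ?Q * g k" by metis
  obtain c where c: "c \<noteq> 0" "det ?M = cst c * ?Q" by (rule det_phi_mat)
  have "?Q \<noteq> 0" using c(2) det_phi_mat_nonzero[of l] by auto
  define h where "h = (\<lambda>j. restr l (cst (1 / c) * g (j - 1)))"
  show ?thesis
  proof (rule that)
    fix i assume i: "i \<in> {1..l}"
    have "?Q * (cst c * f i) = (\<Sum>j=1..l. x $ (j - 1) * ((- 1) ^ j * phi_poly l j (X i)))"
      using phi_mat_mult_vec[OF x i] Mx i by (auto simp: b_def c(2) mult_ac)
    also have "\<dots> = ?Q * (\<Sum>j=1..l. g (j - 1) * ((- 1) ^ j * phi_poly l j (X i)))"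
      unfolding sum_distrib_left using g[of "_ - 1"]
      by (intro sum.cong refl) (auto simp: mult.assoc)
    finally have "cst c * f i = (\<Sum>j=1..l. g (j - 1) * ((- 1) ^ j * phi_poly l j (X i)))"
      using \<open>?Q \<noteq> 0\<close> by simp
    then have "cst (1 / c) * (cst c * f i)
        = (\<Sum>j=1..l. cst (1 / c) * g (j - 1) * ((- 1) ^ j * phi_poly l j (X i)))"
      by (simp add: sum_distrib_left mult.assoc)
    also have "cst (1 / c) * (cst c * f i) = f i"
      using c(1) by (simp flip: mult.assoc cst_mult)
    finally have "restr l (f i)
        = restr l (\<Sum>j=1..l. cst (1 / c) * g (j - 1) * ((- 1) ^ j * phi_poly l j (X i)))" by simp
    also have "\<dots> = (\<Sum>j=1..l. h j * ((- 1) ^ j * restr l (phi_poly l j (X i))))"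
      by (simp add: restr_def h_def)
    also have "\<dots> = (\<Sum>j=1..l. h j * ((- 1) ^ j * phi_poly l j (X i)))"
      using i by (intro sum.cong refl) (auto simp: restr_ident phi_poly_in_S S_indet)
    finally show "f i = (\<Sum>j=1..l. h j * ((- 1) ^ j * phi_poly l j (X i)))"
      using f[OF i] by (simp add: restr_ident)
  qed (simp add: h_def restr_in_S)
qed

section \<open>The basis\<close>

lemma Der_form:
  assumes "\<theta> \<in> Der l" "a \<in> {1..l}" "b \<in> {1..l}"
  shows "\<theta> (pos_root a b X) = pos_root a b (\<lambda>i. \<theta> (X i))"
    and "\<theta> (pos_root a b X - Z) = pos_root a b (\<lambda>i. \<theta> (X i)) - \<theta> Z"
proof -
  show pos_root: "\<theta> (pos_root a b X) = pos_root a b (\<lambda>i. \<theta> (X i))"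
    using assms by (auto simp: pos_root_def Der_add Der_diff S_indet)
  have "pos_root a b X \<in> S l" using form_in_S[of a l b False] assms(2,3) by (simp add: form_def)
  then show "\<theta> (pos_root a b X - Z) = pos_root a b (\<lambda>i. \<theta> (X i)) - \<theta> Z"
    using assms(1) by (simp add: Der_diff S_indet pos_root)
qed

text \<open>The conditions for \<open>\<alpha>\<close> and \<open>\<alpha> - z\<close> are merged into one with a Boolean parameter.\<close>

lemma D_Shi_C_iff:
  assumes \<theta>: "\<theta> \<in> Der l"
  shows "\<theta> \<in> D_Shi_C l \<longleftrightarrow> Z dvd \<theta> Z \<and> (\<forall>d. \<forall>a\<in>{1..l}. \<forall>b\<in>{1..l}.
    form d a b dvd pos_root a b (\<lambda>i. \<theta> (X i)) - of_bool d * \<theta> Z)"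
proof -
  let ?R = "\<lambda>d a b. form d a b dvd pos_root a b (\<lambda>i. \<theta> (X i)) - of_bool d * \<theta> Z"
  let ?P = "\<lambda>\<alpha>. dvd_in (S l) \<alpha> (\<theta> \<alpha>) \<and> dvd_in (S l) (\<alpha> - Z) (\<theta> (\<alpha> - Z))"
  have P: "?P (pos_root a b X) \<longleftrightarrow> ?R False a b \<and> ?R True a b" if ab: "a \<in> {1..l}" "b \<in> {1..l}" for a b
  proof -
    have "pos_root a b X \<in> S l" "pos_root a b X - Z \<in> S l"
      using form_in_S[of a l b False] form_in_S[of a l b True] ab by (simp_all add: form_def)
    then have "?P (pos_root a b X) \<longleftrightarrow>
        pos_root a b X dvd \<theta> (pos_root a b X) \<and> pos_root a b X - Z dvd \<theta> (pos_root a b X - Z)"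
      using Der_S[OF \<theta>] by (simp only: dvd_in_S_iff)
    then show ?thesis
      unfolding Der_form[OF \<theta> ab] by (simp add: form_def)
  qed
  have "(\<forall>\<alpha>\<in>pos_roots_C l. ?P \<alpha>) \<longleftrightarrow> (\<forall>a\<in>{1..l}. \<forall>b\<in>{1..l}. ?P (pos_root a b X))"
    unfolding pos_roots_C_eq by blast
  also have "\<dots> \<longleftrightarrow> (\<forall>a\<in>{1..l}. \<forall>b\<in>{1..l}. ?R False a b \<and> ?R True a b)"
    by (intro ball_cong refl P)
  also have "\<dots> \<longleftrightarrow> (\<forall>d. \<forall>a\<in>{1..l}. \<forall>b\<in>{1..l}. ?R d a b)"
    unfolding all_bool_eq by blast
  finally have "(\<forall>\<alpha>\<in>pos_roots_C l. ?P \<alpha>) \<longleftrightarrow> (\<forall>d. \<forall>a\<in>{1..l}. \<forall>b\<in>{1..l}. ?R d a b)" .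
  moreover have "dvd_in (S l) Z (\<theta> Z) \<longleftrightarrow> Z dvd \<theta> Z"
    using Der_S[OF \<theta>] by (intro dvd_in_S_iff) (simp_all add: S_indet)
  ultimately show ?thesis
    unfolding D_Shi_C_def mem_Collect_eq using \<theta> by (simp only: simp_thms)
qed

lemma euler_eq: "euler l = der l X"
  by (auto simp: euler_def der_def sum.atLeast_Suc_atMost)

lemma phi_C_eq: "phi_C l j = der l (\<lambda>i. if i = 0 then 0 else (- 1) ^ j * phi_poly l j (X i))"
proof -
  have "(\<Sum>i=1..l. (- 1) ^ j * (phi_coeff l j i * partial i f))
    = (\<Sum>i=1..l. (if i = 0 then 0 else (- 1) ^ j * phi_poly l j (X i)) * partial i f)" for f
    by (intro sum.cong refl) (simp add: phi_coeff_eq mult.assoc)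
  then show ?thesis
    unfolding phi_C_def der_def by (simp add: sum_distrib_left sum.atLeast_Suc_atMost[of 0])
qed

lemma euler_in_Der: "euler l \<in> Der l"
  unfolding euler_eq by (intro der_in_Der S_indet)

lemma phi_C_in_Der: "j \<le> l \<Longrightarrow> phi_C l j \<in> Der l"
  unfolding phi_C_eq
  by (intro der_in_Der) (auto intro!: S_0 S_mult S_power S_uminus S_1 phi_poly_in_S S_indet)

lemma euler_indet: "i \<le> l \<Longrightarrow> euler l (X i) = X i"
  by (simp add: euler_eq der_indet)

lemma phi_C_indet: "i \<le> l \<Longrightarrow> phi_C l j (X i) = (if i = 0 then 0 else (- 1) ^ j * phi_poly l j (X i))"
  by (simp add: phi_C_eq der_indet)

lemma euler_in_D_Shi_C: "euler l \<in> D_Shi_C l"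
proof -
  have "pos_root a b (\<lambda>i. euler l (X i)) = pos_root a b X" if "a \<in> {1..l}" "b \<in> {1..l}" for a b
    using that by (intro pos_root_cong) (simp_all add: euler_indet)
  then show ?thesis
    by (auto simp: D_Shi_C_iff[OF euler_in_Der] euler_indet form_def)
qed

lemma phi_C_in_D_Shi_C:
  assumes j: "1 \<le> j" "j \<le> l"
  shows "phi_C l j \<in> D_Shi_C l"
proof -
  have "admissible l (\<lambda>i. (- 1) ^ j * phi_poly l j (X i))"
    by (intro admissible_scale admissible_phi j)
  then have "admissible l (\<lambda>i. phi_C l j (X i))"
    by (rule admissible_cong[THEN iffD1, rotated]) (simp add: phi_C_indet)
  then show ?thesis
    by (auto simp: D_Shi_C_iff[OF phi_C_in_Der[OF j(2)]] phi_C_indet admissible_def)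
qed

lemma lin_comb_in_Der:
  assumes "\<And>k. k \<in> K \<Longrightarrow> c k \<in> S l" "\<And>k. k \<in> K \<Longrightarrow> b k \<in> Der l"
  shows "lin_comb l K c b \<in> Der l"
proof -
  have "lin_comb l K c b \<in> S l \<rightarrow>\<^sub>E S l"
  proof -
    have "c k * b k f \<in> S l" if "k \<in> K" "f \<in> S l" for k f
      using S_mult[OF assms(1) Der_S[OF assms(2)]] that by blast
    then show ?thesis by (auto simp: lin_comb_def intro: S_sum)
  qed
  moreover have "(\<Sum>k\<in>K. c k * b k (f + g)) = (\<Sum>k\<in>K. c k * b k f) + (\<Sum>k\<in>K. c k * b k g)"
    if "f \<in> S l" "g \<in> S l" for f g
    unfolding sum.distrib[symmetric] using assms that
    by (intro sum.cong refl) (simp add: Der_add[where l = l] distrib_left)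
  moreover have "(\<Sum>k\<in>K. c k * b k (cst r * f)) = cst r * (\<Sum>k\<in>K. c k * b k f)"
    if "f \<in> S l" for f r
    unfolding sum_distrib_left using assms that
    by (intro sum.cong refl) (simp add: Der_scale[where l = l] mult.left_commute)
  moreover have "(\<Sum>k\<in>K. c k * b k (f * g)) = (\<Sum>k\<in>K. c k * b k f) * g + f * (\<Sum>k\<in>K. c k * b k g)"
    if "f \<in> S l" "g \<in> S l" for f g
    unfolding sum_distrib_left sum_distrib_right sum.distrib[symmetric] using assms that
    by (intro sum.cong refl) (simp add: Der_mult[where l = l] algebra_simps)
  ultimately show ?thesis
    unfolding Der_def by (simp add: lin_comb_def S_add S_mult S_cst)
qed

lemma lin_comb_in_D_Shi_C:
  assumes "\<And>k. k \<in> K \<Longrightarrow> c k \<in> S l" "\<And>k. k \<in> K \<Longrightarrow> b k \<in> D_Shi_C l"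
  shows "lin_comb l K c b \<in> D_Shi_C l"
proof -
  have Der: "b k \<in> Der l" if "k \<in> K" for k
    using assms(2)[OF that] by (simp add: D_Shi_C_def)
  have indet: "lin_comb l K c b (X i) = (\<Sum>k\<in>K. c k * b k (X i))" if "i \<le> l" for i
    using that by (simp add: lin_comb_def S_indet)
  have "Z dvd lin_comb l K c b Z"
    using assms(2) Der by (auto simp: indet D_Shi_C_iff intro!: dvd_sum dvd_mult)
  moreover have "form d p q dvd pos_root p q (\<lambda>i. lin_comb l K c b (X i)) - of_bool d * lin_comb l K c b Z"
    if pq: "p \<in> {1..l}" "q \<in> {1..l}" for d p q
  proof -
    have "pos_root p q (\<lambda>i. lin_comb l K c b (X i)) = pos_root p q (\<lambda>i. \<Sum>k\<in>K. c k * b k (X i))"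
      using pq by (intro pos_root_cong) (simp_all add: indet)
    then have "pos_root p q (\<lambda>i. lin_comb l K c b (X i)) - of_bool d * lin_comb l K c b Z
        = (\<Sum>k\<in>K. c k * (pos_root p q (\<lambda>i. b k (X i)) - of_bool d * b k Z))"
      by (cases d) (simp_all add: pos_root_sum pos_root_scale indet right_diff_distrib sum_subtractf)
    moreover have "form d p q dvd pos_root p q (\<lambda>i. b k (X i)) - of_bool d * b k Z" if "k \<in> K" for k
      using assms(2)[OF that] D_Shi_C_iff[OF Der[OF that]] pq by blast
    ultimately show ?thesis
      by (auto intro!: dvd_sum dvd_mult)
  qed
  moreover have "lin_comb l K c b \<in> Der l" using assms(1) Der by (rule lin_comb_in_Der)
  ultimately show ?thesis by (simp add: D_Shi_C_iff)
qed

abbreviation (input) basis_C :: "nat \<Rightarrow> nat \<Rightarrow> mpoly \<Rightarrow> mpoly" where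
  "basis_C l \<equiv> (\<lambda>k. if k = 0 then euler l else phi_C l k)"

lemma lin_comb_basis_indet:
  assumes "i \<le> l"
  shows "lin_comb l {0..l} c (basis_C l) (X i) = c 0 * X i
    + (if i = 0 then 0 else \<Sum>j=1..l. c j * ((- 1) ^ j * phi_poly l j (X i)))"
proof -
  have "lin_comb l {0..l} c (basis_C l) (X i) = c 0 * euler l (X i) + (\<Sum>j=1..l. c j * basis_C l j (X i))"
    using assms by (simp add: lin_comb_def S_indet sum.atLeast_Suc_atMost[of 0])
  also have "(\<Sum>j=1..l. c j * basis_C l j (X i))
      = (if i = 0 then 0 else \<Sum>j=1..l. c j * ((- 1) ^ j * phi_poly l j (X i)))"
    using assms by (auto simp: phi_C_indet intro!: sum.neutral sum.cong)
  finally show ?thesis using assms by (simp add: euler_indet)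
qed

theorem theorem4p8:
  fixes l :: nat
  assumes "l \<ge> 1"
  shows "euler l \<in> D_Shi_C l \<and>
    (\<forall>j \<in> {1..l}. phi_C l j \<in> D_Shi_C l) \<and>
    is_basis l {0..l} (\<lambda>k. if k = 0 then euler l else phi_C l k) (D_Shi_C l)"
proof (intro conjI ballI)
  show "euler l \<in> D_Shi_C l" by (rule euler_in_D_Shi_C)
  show "phi_C l j \<in> D_Shi_C l" if "j \<in> {1..l}" for j using that by (intro phi_C_in_D_Shi_C) auto
  have basis_mem: "basis_C l k \<in> D_Shi_C l" if "k \<in> {0..l}" for k
    using that by (auto intro: euler_in_D_Shi_C phi_C_in_D_Shi_C)
  show "is_basis l {0..l} (basis_C l) (D_Shi_C l)"
    unfolding is_basis_def
  proof (intro conjI equalityI subsetI ballI impI)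
    fix \<theta> assume "\<theta> \<in> {lin_comb l {0..l} c (basis_C l) |c. c \<in> {0..l} \<rightarrow> S l}"
    then obtain c where "c \<in> {0..l} \<rightarrow> S l" "\<theta> = lin_comb l {0..l} c (basis_C l)" by blast
    then show "\<theta> \<in> D_Shi_C l" using basis_mem by (auto intro!: lin_comb_in_D_Shi_C)
  next
    fix \<theta> assume \<theta>: "\<theta> \<in> D_Shi_C l"
    then have Der: "\<theta> \<in> Der l" and "dvd_in (S l) Z (\<theta> Z)" by (auto simp: D_Shi_C_def)
    then obtain q where q: "q \<in> S l" "\<theta> Z = Z * q" by (auto simp: dvd_in_def)
    let ?f = "\<lambda>i. \<theta> (X i) - q * X i"
    \<comment> \<open>subtracting the multiple \<open>q\<close> of the Euler derivation makes the value at \<open>z\<close> vanish\<close>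
    have "form d a b dvd pos_root a b ?f" if ab: "a \<in> {1..l}" "b \<in> {1..l}" for d a b
    proof -
      have "pos_root a b ?f = (pos_root a b (\<lambda>i. \<theta> (X i)) - of_bool d * \<theta> Z) - q * form d a b"
        by (simp add: pos_root_diff pos_root_scale q(2) form_def algebra_simps)
      moreover have "form d a b dvd pos_root a b (\<lambda>i. \<theta> (X i)) - of_bool d * \<theta> Z"
        using \<theta> D_Shi_C_iff[OF Der] ab by blast
      ultimately show ?thesis by (simp add: dvd_diff)
    qed
    then have "admissible l ?f" by (simp add: admissible_def)
    moreover have "?f i \<in> S l" if "i \<in> {1..l}" for i
      using that q(1) by (intro S_diff S_mult Der_S[OF Der] S_indet) auto
    ultimately obtain h where h: "\<And>j. h j \<in> S l"
      "\<And>i. i \<in> {1..l} \<Longrightarrow> ?f i = (\<Sum>j=1..l. h j * ((- 1) ^ j * phi_poly l j (X i)))"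
      by (rule admissible_spanned[of l ?f]) auto
    define c where "c = h(0 := q)"
    have c: "c \<in> {0..l} \<rightarrow> S l" using h(1) q(1) by (auto simp: c_def)
    have "\<theta> = lin_comb l {0..l} c (basis_C l)"
    proof (rule Der_eqI[OF Der])
      show "lin_comb l {0..l} c (basis_C l) \<in> Der l"
        using c basis_mem by (intro lin_comb_in_Der) (auto simp: D_Shi_C_def)
      fix i assume i: "i \<le> l"
      have "(\<Sum>j=1..l. c j * ((- 1) ^ j * phi_poly l j (X i)))
          = (\<Sum>j=1..l. h j * ((- 1) ^ j * phi_poly l j (X i)))"
        by (intro sum.cong) (auto simp: c_def)
      then show "\<theta> (X i) = lin_comb l {0..l} c (basis_C l) (X i)"
        using h(2)[of i] i q(2) unfolding lin_comb_basis_indet[OF i]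
        by (cases "i = 0") (auto simp: c_def algebra_simps)
    qed
    with c show "\<theta> \<in> {lin_comb l {0..l} c (basis_C l) |c. c \<in> {0..l} \<rightarrow> S l}" by blast
  next
    fix c k assume c: "c \<in> {0..l} \<rightarrow> S l" "lin_comb l {0..l} c (basis_C l) = (\<lambda>f\<in>S l. 0)"
      and k: "k \<in> {0..l}"
    have zero: "lin_comb l {0..l} c (basis_C l) (X i) = 0" if "i \<le> l" for i
      unfolding c(2) using that by (simp add: S_indet)
    have c0: "c 0 = 0" using zero[of 0] lin_comb_basis_indet[of 0 l c] by simp
    have "(\<Sum>j=1..l. (c j * (- 1) ^ j) * phi_poly l j (X i)) = 0" if "i \<in> {1..l}" for i
      using zero[of i] lin_comb_basis_indet[of i l c] c0 that by (simp add: mult.assoc)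
    then have "c j * (- 1) ^ j = 0" if "j \<in> {1..l}" for j
      using phi_independent[of l "\<lambda>j. c j * (- 1) ^ j" j] that by blast
    then have "c j = 0" if "j \<in> {1..l}" for j using that by simp
    with c0 k show "c k = 0" by (cases "k = 0") auto
  qed simp
qed

end
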